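(* Let $(a,d)\in\mathbb{R}^2$ with $|a-d|=2$ and $a\neq\pm1$, and let $A_4=\begin{pmatrix} a & -1\\ 1 & d\end{pmatrix}$. If $(a,d)=(1/2,-3/2)$ or $(a,d)=(-1/2,3/2)$, then $\mathrm{Spec}(A_4D)=\{0\}$. Otherwise $\mathrm{Spec}(A_4D)$ is infinite but it only intersects the real line in a finite number of points.
   Context: Let $W^{2,2}$ be the Sobolev space of all $f\in L^2(0,1)\otimes\mathbb{C}^2$ whose generalized derivative $f''$ lies in $L^2(0,1)\otimes\mathbb{C}^2$, and write $f=\begin{pmatrix}\phi\\ \gamma\end{pmatrix}$. The operator $D$ acts on $L^2(0,1)\otimes\mathbb{C}^2$ by $Df=-f''$ with domain $\mathrm{Dom}(D)=\{f\in W^{2,2}:\phi(0)=\phi(1)=0,\ \gamma'(0)=\gamma'(1)=0\}$. For a constant $2\times2$ matrix $A$, $AD$ is the operator $f\mapsto -Af''$ with domain $\mathrm{Dom}(D)$. $\mathrm{Spec}$ denotes the spectrum. *)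

theory Defs
  imports "HOL-Analysis.Analysis"
begin

text \<open>
  Elements of L^2(0,1) tensor C^2 are represented by functions real => complex^2, of which only
  the values on the open interval (0,1) matter; equality of elements is equality almost everywhere
  there. In f = (phi, gamma), phi is component 1 and gamma is component 2. The norm on complex^2
  is the Euclidean one.
\<close>

abbreviation M01 :: "real measure" where
  "M01 \<equiv> lebesgue_on {0<..<1}"

definition L2 :: "(real \<Rightarrow> complex^2) set" where
  "L2 = {f \<in> borel_measurable M01. integrable M01 (\<lambda>x. (norm (f x))\<^sup>2)}"

definition L2_norm :: "(real \<Rightarrow> complex^2) \<Rightarrow> real" where
  "L2_norm f = sqrt (LINT x|M01. (norm (f x))\<^sup>2)"

definition eq_ae :: "(real \<Rightarrow> complex^2) \<Rightarrow> (real \<Rightarrow> complex^2) \<Rightarrow> bool" where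
  "eq_ae f g \<longleftrightarrow> (AE x in M01. f x = g x)"

text \<open>A closed subset of the line contained in (0,1) is automatically compact.\<close>

definition test_function :: "(real \<Rightarrow> real) \<Rightarrow> bool" where
  "test_function \<psi> \<longleftrightarrow>
     (\<forall>n x. (deriv ^^ n) \<psi> differentiable (at x)) \<and> closure {x. \<psi> x \<noteq> 0} \<subseteq> {0<..<1}"

definition has_generalized_deriv2 :: "(real \<Rightarrow> complex^2) \<Rightarrow> (real \<Rightarrow> complex^2) \<Rightarrow> bool" where
  "has_generalized_deriv2 f g \<longleftrightarrow>
     (\<forall>\<psi>. test_function \<psi> \<longrightarrow>
        (LINT x|M01. deriv (deriv \<psi>) x *\<^sub>R f x) = (LINT x|M01. \<psi> x *\<^sub>R g x))"

definition W22 :: "(real \<Rightarrow> complex^2) set" where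
  "W22 = {f \<in> L2. \<exists>g\<in>L2. has_generalized_deriv2 f g}"

text \<open>The generalized second derivative is unique up to equality almost everywhere.\<close>

definition generalized_deriv2 :: "(real \<Rightarrow> complex^2) \<Rightarrow> real \<Rightarrow> complex^2" where
  "generalized_deriv2 f = (SOME g. g \<in> L2 \<and> has_generalized_deriv2 f g)"

text \<open>
  Every element of W22 has exactly one representative that is continuously differentiable on the
  closed interval [0,1] (one-sided derivatives at the endpoints). The boundary values of f and f'
  are those of this representative u and of its derivative u'.
\<close>

definition C1_representative ::
    "(real \<Rightarrow> complex^2) \<Rightarrow> (real \<Rightarrow> complex^2) \<Rightarrow> (real \<Rightarrow> complex^2) \<Rightarrow> bool" where
  "C1_representative f u u' \<longleftrightarrow>
     eq_ae f u \<and>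
     (\<forall>x\<in>{0..1}. (u has_vector_derivative u' x) (at x within {0..1})) \<and>
     continuous_on {0..1} u'"

definition Dom_D :: "(real \<Rightarrow> complex^2) set" where
  "Dom_D = {f \<in> W22. \<exists>u u'. C1_representative f u u' \<and>
      u 0 $ 1 = 0 \<and> u 1 $ 1 = 0 \<and> u' 0 $ 2 = 0 \<and> u' 1 $ 2 = 0}"

definition op_D :: "(real \<Rightarrow> complex^2) \<Rightarrow> real \<Rightarrow> complex^2" where
  "op_D f = (\<lambda>x. - generalized_deriv2 f x)"

definition op_AD :: "complex^2^2 \<Rightarrow> (real \<Rightarrow> complex^2) \<Rightarrow> real \<Rightarrow> complex^2" where
  "op_AD A f = (\<lambda>x. A *v op_D f x)"

text \<open>
  For an operator T with domain S in L^2, z lies in the resolvent set iff T - z maps S bijectively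
  onto L^2 (injectivity, surjectivity, modulo equality almost everywhere) and the inverse is bounded.
\<close>

definition resolvent_set ::
    "(real \<Rightarrow> complex^2) set \<Rightarrow> ((real \<Rightarrow> complex^2) \<Rightarrow> real \<Rightarrow> complex^2) \<Rightarrow> complex set" where
  "resolvent_set S T = {z. let R = (\<lambda>f x. T f x - z *s f x) in
      (\<forall>f\<in>S. \<forall>h\<in>S. eq_ae (R f) (R h) \<longrightarrow> eq_ae f h) \<and>
      (\<forall>g\<in>L2. \<exists>f\<in>S. eq_ae (R f) g) \<and>
      (\<exists>C. \<forall>f\<in>S. L2_norm f \<le> C * L2_norm (R f))}"

definition Spec ::
    "(real \<Rightarrow> complex^2) set \<Rightarrow> ((real \<Rightarrow> complex^2) \<Rightarrow> real \<Rightarrow> complex^2) \<Rightarrow> complex set" where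
  "Spec S T = - resolvent_set S T"

definition A4 :: "real \<Rightarrow> real \<Rightarrow> complex^2^2" where
  "A4 a d = vector [vector [of_real a, -1], vector [1, of_real d]]"

end

theory Submission
  imports Defs "HOL-Complex_Analysis.Complex_Analysis" "HOL-Real_Asymp.Real_Asymp"
begin

text \<open>
  Since \<open>\<bar>a - d\<bar> = 2\<close>, the matrix is \<open>m I + N\<close> with \<open>m = (a + d) / 2 \<noteq> 0\<close> and \<open>N\<^sup>2 = 0\<close>. With
  \<open>\<sigma> = (a - d) / 2 = \<plusminus>1\<close>, \<open>z = m k\<^sup>2 \<noteq> 0\<close>, \<open>p = \<sigma> \<phi> - \<gamma>\<close> and \<open>q = \<phi>\<close>, the resolvent equation becomes the
  triangular system \<open>p'' = - k\<^sup>2 p + h1\<close>, \<open>q'' = - k\<^sup>2 q + (k\<^sup>2 / m) p + h2\<close>, which Duhamel's formula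
  solves explicitly. The conditions at 0 leave \<open>p 0\<close> and \<open>p' 0\<close> free, and those at 1 are a 2 by 2 linear
  system for them whose determinant is a nonzero multiple of \<open>k\<^sup>2 - (1 + 2 m \<sigma>)\<^sup>2 (sin k)\<^sup>2\<close>. So a
  nonzero \<open>z\<close> is in the spectrum iff this vanishes. In the two exceptional cases \<open>1 + 2 m \<sigma> = 0\<close> and
  there is no such \<open>k\<close>; otherwise the Great Picard theorem for \<open>w sin (1 / w)\<close> at 0 gives infinitely
  many \<open>k\<close>, while those with real \<open>k\<^sup>2\<close> are bounded, hence finite in number.
\<close>

text \<open>Hence all calculus is done with absolutely continuous functions: by the du Bois-Reymond
  lemma, having the weak second derivative g means that u' is an indefinite integral of g, and a
  product rule for such functions carries Duhamel's formula through for merely integrable data. The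
  choice of p is forced: (\<sigma>, -1) is a left eigenvector of the matrix for its double
  eigenvalue m, so p obeys an equation of its own and drives q at resonance. This produces the terms
  x sin(k x) and x cos(k x), and with them a characteristic equation that compares k with sin k.
  Since \<gamma>' = \<sigma> q' - p', the boundary conditions read q = 0 and q' = \<sigma> p' at
  both ends. The assumption on a guarantees m \<noteq> 0, because a = m + \<sigma>. The point 0 lies
  outside the substitution for z and has the constant eigenfunction (0, 1). Great Picard permits one
  exceptional value, but the squared equation offers two targets, 1/b and -1/b with b = 1 + 2 m
  \<sigma>.\<close>

no_notation fps_nth (infixl "$" 75)

section \<open>Primitives of integrable functions\<close>

text \<open>Absolute continuity on \<open>[0,1]\<close>: \<open>f\<close> is the derivative of \<open>F\<close> only almost everywhere.\<close>

definition primitive01 :: "(real \<Rightarrow> 'a::euclidean_space) \<Rightarrow> (real \<Rightarrow> 'a) \<Rightarrow> bool" where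
  "primitive01 F f \<longleftrightarrow> f absolutely_integrable_on {0..1} \<and>
     (\<forall>x\<in>{0..1}. integral {0..x} f = F x - F 0)"

lemma primitive01_integrable_sub:
  assumes "primitive01 F f" "0 \<le> x" "y \<le> 1"
  shows "f absolutely_integrable_on {x..y}" "f integrable_on {x..y}"
proof -
  show "f absolutely_integrable_on {x..y}"
    using absolutely_integrable_on_subinterval[where S="{0..1}" and f=f and a=x and b=y] assms
    by (auto simp: primitive01_def)
  then show "f integrable_on {x..y}"
    by (simp add: absolutely_integrable_on_def)
qed

lemma primitive01_diff:
  assumes "primitive01 F f" "0 \<le> x" "x \<le> y" "y \<le> 1"
  shows "F y - F x = integral {x..y} f"
proof -
  have "integral {0..x} f + integral {x..y} f = integral {0..y} f"
    by (rule Henstock_Kurzweil_Integration.integral_combine)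
       (use assms primitive01_integrable_sub[OF assms(1), of 0 y] in auto)
  moreover have "integral {0..x} f = F x - F 0" "integral {0..y} f = F y - F 0"
    using assms by (auto simp: primitive01_def)
  ultimately show ?thesis by (simp add: algebra_simps)
qed

lemma primitive01_continuous:
  assumes "primitive01 F f" shows "continuous_on {0..1} F"
proof -
  have "continuous_on {0..1} (\<lambda>x. F 0 + integral {0..x} f)"
    using primitive01_integrable_sub(2)[OF assms, of 0 1]
    by (intro continuous_intros indefinite_integral_continuous_1) auto
  then show ?thesis
    using assms by (subst continuous_on_cong[OF refl]) (auto simp: primitive01_def)
qed

lemma primitive01_integral:
  assumes "f absolutely_integrable_on {0..1}"
  shows "primitive01 (\<lambda>x. integral {0..x} f) f"
  using assms by (auto simp: primitive01_def)

lemma primitive01_C1: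
  assumes "\<And>x. x \<in> {0..1} \<Longrightarrow> (F has_vector_derivative f x) (at x within {0..1})"
    and "continuous_on {0..1} f"
  shows "primitive01 F f"
  unfolding primitive01_def
proof (intro conjI ballI)
  show "f absolutely_integrable_on {0..1}"
    by (rule absolutely_integrable_continuous_real) fact
  fix x :: real assume x: "x \<in> {0..1}"
  have "(f has_integral (F x - F 0)) {0..x}"
    using x by (intro fundamental_theorem_of_calculus)
      (auto intro: has_vector_derivative_within_subset[OF assms(1)])
  then show "integral {0..x} f = F x - F 0" by (rule integral_unique)
qed

lemma primitive01_has_vector_derivative:
  assumes "primitive01 F f" "continuous_on {0..1} f" "x \<in> {0..1}"
  shows "(F has_vector_derivative f x) (at x within {0..1})"
proof -
  have "((\<lambda>x. F 0 + integral {0..x} f) has_vector_derivative f x) (at x within {0..1})"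
    using integral_has_vector_derivative[OF assms(2,3)]
    by (auto intro!: derivative_eq_intros)
  then show ?thesis
    by (rule has_vector_derivative_transform[OF assms(3), rotated])
       (use assms in \<open>auto simp: primitive01_def\<close>)
qed

text \<open>Integrals do not see null sets, so an equation known only almost everywhere may be
  substituted for the derivative, whereas the primitive has to agree at every point.\<close>

lemma primitive01_cong_AE:
  assumes "primitive01 F f" "negligible N" "\<And>x. x \<in> {0..1} - N \<Longrightarrow> g x = f x"
    and "\<And>x. x \<in> {0..1} \<Longrightarrow> G x = F x"
  shows "primitive01 G g"
  unfolding primitive01_def
proof (intro conjI ballI)
  show "g absolutely_integrable_on {0..1}"
    using absolutely_integrable_spike[where f=f and T="{0..1}" and S=N and g=g] assms by (auto simp: primitive01_def)
  fix x :: real assume x: "x \<in> {0..1}"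
  have "integral {0..x} g = integral {0..x} f"
    by (rule integral_spike[OF assms(2)]) (use assms(3) x in auto)
  then show "integral {0..x} g = G x - G 0"
    using assms x by (auto simp: primitive01_def)
qed

lemma primitive01_cong:
  assumes "primitive01 F f" "\<And>x. x \<in> {0..1} \<Longrightarrow> g x = f x" "\<And>x. x \<in> {0..1} \<Longrightarrow> G x = F x"
  shows "primitive01 G g"
  by (rule primitive01_cong_AE[OF assms(1), of "{}"]) (use assms in auto)

lemma primitive01_add:
  assumes "primitive01 F f" "primitive01 G g"
  shows "primitive01 (\<lambda>x. F x + G x) (\<lambda>x. f x + g x)"
proof -
  have "integral {0..x} (\<lambda>x. f x + g x) = integral {0..x} f + integral {0..x} g"
    if "x \<in> {0..1}" for x
    by (rule Henstock_Kurzweil_Integration.integral_add)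
       (use that primitive01_integrable_sub(2)[OF assms(1), of 0 x]
            primitive01_integrable_sub(2)[OF assms(2), of 0 x] in auto)
  then show ?thesis
    using assms by (auto simp: primitive01_def)
qed

lemma primitive01_linear:
  fixes h :: "'a::euclidean_space \<Rightarrow> 'b::euclidean_space"
  assumes "primitive01 F f" "bounded_linear h"
  shows "primitive01 (\<lambda>x. h (F x)) (\<lambda>x. h (f x))"
  unfolding primitive01_def
proof (intro conjI ballI)
  interpret bounded_linear h by fact
  show "(\<lambda>x. h (f x)) absolutely_integrable_on {0..1}"
    using absolutely_integrable_linear[where f=f and s="{0..1}" and h=h] assms by (auto simp: primitive01_def o_def)
  fix x :: real assume x: "x \<in> {0..1}"
  have "integral {0..x} (\<lambda>x. h (f x)) = h (integral {0..x} f)"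
    using integral_linear[of f "{0..x}" h] primitive01_integrable_sub(2)[OF assms(1), of 0 x] x assms(2)
    by (auto simp: o_def)
  then show "integral {0..x} (\<lambda>x. h (f x)) = h (F x) - h (F 0)"
    using assms x by (auto simp: primitive01_def diff)
qed

text \<open>Both error terms are controlled by the increment of the indefinite integral of
  \<open>norm f\<close> times the length of the interval, so the difference of the two sides has zero
  derivative everywhere, although \<open>F\<close> itself need not be differentiable at every point.\<close>

lemma primitive01_bilinear:
  fixes prod :: "'a::euclidean_space \<Rightarrow> 'b::euclidean_space \<Rightarrow> 'c::euclidean_space"
  assumes bil: "bounded_bilinear prod"
    and K: "\<And>x. x \<in> {0..1} \<Longrightarrow> (K has_vector_derivative k x) (at x within {0..1})"
    and k: "continuous_on {0..1} k"
    and F: "primitive01 F f"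
  shows "primitive01 (\<lambda>x. prod (K x) (F x)) (\<lambda>x. prod (k x) (F x) + prod (K x) (f x))"
proof -
  interpret bounded_bilinear prod by fact
  let ?g = "\<lambda>x. prod (k x) (F x) + prod (K x) (f x)"
  have Kp: "primitive01 K k" by (rule primitive01_C1[OF K k])
  have contK: "continuous_on {0..1} K" and contF: "continuous_on {0..1} F"
    using Kp F primitive01_continuous by auto
  have bl: "bilinear prod" by (rule bilinear_conv_bounded_bilinear[THEN iffD2, OF bil])
  have fint: "f absolutely_integrable_on {0..1}" using F by (simp add: primitive01_def)
  obtain B where B: "B > 0" "\<And>a b. norm (prod a b) \<le> norm a * norm b * B"
    using pos_bounded by blast
  obtain L where L: "L > 0" "\<And>x. x \<in> {0..1} \<Longrightarrow> norm (k x) \<le> L"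
  proof -
    have "bounded (k ` {0..1})" by (intro compact_imp_bounded compact_continuous_image k) auto
    then show ?thesis using that unfolding bounded_pos by blast
  qed
  have prodint: "(\<lambda>x. prod (G x) (f x)) absolutely_integrable_on {0..1}"
    if "continuous_on {0..1} G" for G :: "real \<Rightarrow> 'a"
  proof (rule absolutely_integrable_bounded_measurable_product[OF bl _ _ _ fint])
    show "G \<in> borel_measurable (lebesgue_on {0..1})"
      by (rule continuous_imp_measurable_on_sets_lebesgue[OF that]) auto
    show "bounded (G ` {0..1})"
      by (intro compact_imp_bounded compact_continuous_image that) auto
  qed auto
  have kFint: "(\<lambda>x. prod (k x) (F x)) absolutely_integrable_on {0..1}"
    by (rule absolutely_integrable_continuous_real) (intro continuous_on k contF)
  have gint: "?g absolutely_integrable_on {0..1}"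
    by (intro set_integral_add(1) kFint prodint contK)
  have sub: "h integrable_on {x..y}"
    if "h absolutely_integrable_on {0..1}" "0 \<le> x" "y \<le> 1" for h :: "real \<Rightarrow> 'd::euclidean_space" and x y
    using absolutely_integrable_on_subinterval[OF that(1), of x y] that(2,3)
    by (auto simp: absolutely_integrable_on_def)
  have nfint: "(\<lambda>x. norm (f x)) absolutely_integrable_on {0..1}"
    using absolutely_integrable_norm[OF fint] by (simp add: o_def)
  define M where "M x = integral {0..x} (\<lambda>x. norm (f x))" for x
  have Mp: "primitive01 M (\<lambda>x. norm (f x))"
    unfolding M_def by (rule primitive01_integral) fact
  define \<Phi> where "\<Phi> x = prod (K x) (F x) - integral {0..x} ?g" for x
  have est: "norm (\<Phi> y - \<Phi> x) \<le> (y - x) * (2 * L * B * (M y - M x))"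
    if xy: "0 \<le> x" "x \<le> y" "y \<le> 1" for x y
  proof -
    have normF: "norm (F s - F r) \<le> M y - M x" if "x \<le> r" "r \<le> s" "s \<le> y" for r s
    proof -
      have "norm (F s - F r) = norm (integral {r..s} f)"
        using primitive01_diff[OF F, of r s] that xy by simp
      also have "\<dots> \<le> integral {r..s} (\<lambda>x. norm (f x))"
        by (rule Henstock_Kurzweil_Integration.integral_norm_bound_integral)
           (use sub[OF fint, of r s] sub[OF nfint, of r s] that xy in auto)
      also have "\<dots> \<le> integral {x..y} (\<lambda>x. norm (f x))"
        by (rule integral_subset_le) (use sub[OF nfint] that xy in auto)
      also have "\<dots> = M y - M x" using primitive01_diff[OF Mp, of x y] xy by simp
      finally show ?thesis .
    qed
    have normK: "norm (K y - K r) \<le> (y - x) * L" if "r \<in> {x..y}" for r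
    proof -
      have "norm (K y - K r) = norm (integral {r..y} k)"
        using primitive01_diff[OF Kp, of r y] that xy by simp
      also have "\<dots> \<le> L * (y - r)"
        by (rule integral_bound) (use that xy in \<open>auto intro!: continuous_on_subset[OF k] L\<close>)
      also have "\<dots> \<le> L * (y - x)"
        using that L(1) by (intro mult_left_mono) auto
      finally show ?thesis by (simp add: mult_ac)
    qed
    have i1: "(\<lambda>r. prod (K y - K r) (f r)) integrable_on {x..y}"
      by (rule sub[OF prodint]) (use xy in \<open>auto intro!: continuous_intros contK\<close>)
    have i2: "(\<lambda>r. prod (k r) (F x - F r)) integrable_on {x..y}"
      by (rule sub[OF absolutely_integrable_continuous_real])
         (use xy in \<open>auto intro!: continuous_on continuous_intros k contF\<close>)
    \<comment> \<open>Freezing \<open>K\<close> at the right end and \<open>F\<close> at the left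
      end makes these two integrals add up exactly to the increment of the product. What remains
      against \<open>?g\<close> is a sum of products of an increment with a derivative.\<close>
    have "((\<lambda>r. prod (K y) (f r)) has_integral prod (K y) (F y - F x)) {x..y}"
      using has_integral_linear[OF integrable_integral[OF sub[OF fint, of x y]] bounded_linear_right[of "K y"]]
        primitive01_diff[OF F, of x y] xy by (simp add: o_def)
    moreover have "((\<lambda>r. prod (k r) (F x)) has_integral prod (K y - K x) (F x)) {x..y}"
      using has_integral_linear[OF integrable_integral[OF primitive01_integrable_sub(2)[OF Kp, of x y]]
          bounded_linear_left[of "F x"]]
        primitive01_diff[OF Kp, of x y] xy by (simp add: o_def)
    moreover have "(?g has_integral integral {0..y} ?g - integral {0..x} ?g) {x..y}"
      using primitive01_diff[OF primitive01_integral[OF gint], of x y]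
        integrable_integral[OF sub[OF gint, of x y]] xy by simp
    ultimately have "((\<lambda>r. (prod (K y) (f r) + prod (k r) (F x)) - ?g r) has_integral
       (prod (K y) (F y - F x) + prod (K y - K x) (F x)) - (integral {0..y} ?g - integral {0..x} ?g)) {x..y}"
      by (intro has_integral_diff has_integral_add)
    then have "((\<lambda>r. prod (K y - K r) (f r) + prod (k r) (F x - F r)) has_integral \<Phi> y - \<Phi> x) {x..y}"
      unfolding \<Phi>_def by (rule has_integral_eq_rhs[OF has_integral_eq, rotated])
        (auto simp: diff_left diff_right algebra_simps)
    then have "\<Phi> y - \<Phi> x = integral {x..y} (\<lambda>r. prod (K y - K r) (f r)) + integral {x..y} (\<lambda>r. prod (k r) (F x - F r))"
      using Henstock_Kurzweil_Integration.integral_add[OF i1 i2] by (simp add: integral_unique)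
    also have "norm \<dots> \<le> (y - x) * L * B * (M y - M x) + (y - x) * L * B * (M y - M x)"
    proof (rule norm_triangle_mono)
      have "norm (integral {x..y} (\<lambda>r. prod (K y - K r) (f r)))
          \<le> integral {x..y} (\<lambda>r. (y - x) * L * B * norm (f r))"
      proof (rule Henstock_Kurzweil_Integration.integral_norm_bound_integral[OF i1])
        show "(\<lambda>r. (y - x) * L * B * norm (f r)) integrable_on {x..y}"
          using sub[OF nfint, of x y] xy integrable_cmul[of "\<lambda>r. norm (f r)" "{x..y}" "(y - x) * L * B"]
          by auto
        fix r assume r: "r \<in> {x..y}"
        have "norm (prod (K y - K r) (f r)) \<le> norm (K y - K r) * norm (f r) * B" by (rule B)
        also have "\<dots> \<le> ((y - x) * L) * norm (f r) * B"
          using normK[OF r] B(1) by (intro mult_right_mono) auto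
        finally show "norm (prod (K y - K r) (f r)) \<le> (y - x) * L * B * norm (f r)"
          by (simp add: mult_ac)
      qed
      also have "\<dots> = (y - x) * L * B * (M y - M x)"
        using primitive01_diff[OF Mp, of x y] xy by simp
      finally show "norm (integral {x..y} (\<lambda>r. prod (K y - K r) (f r))) \<le> \<dots>" .
      have "norm (integral {x..y} (\<lambda>r. prod (k r) (F x - F r)))
          \<le> integral {x..y} (\<lambda>r. L * B * (M y - M x))"
      proof (rule Henstock_Kurzweil_Integration.integral_norm_bound_integral[OF i2])
        fix r assume r: "r \<in> {x..y}"
        have "norm (prod (k r) (F x - F r)) \<le> norm (k r) * norm (F x - F r) * B" by (rule B)
        also have "\<dots> \<le> L * (M y - M x) * B"
          using L normF[of x r] r xy B(1)
          by (intro mult_right_mono mult_mono) (auto simp: norm_minus_commute)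
        finally show "norm (prod (k r) (F x - F r)) \<le> L * B * (M y - M x)"
          by (simp add: mult_ac)
      qed auto
      also have "\<dots> = (y - x) * L * B * (M y - M x)" using xy by simp
      finally show "norm (integral {x..y} (\<lambda>r. prod (k r) (F x - F r))) \<le> \<dots>" .
    qed
    finally show ?thesis by (simp add: algebra_simps)
  qed
  have "(\<Phi> has_vector_derivative 0) (at x within {0..1})" if x: "x \<in> {0..1}" for x
    unfolding has_vector_derivative_def
  proof (rule has_derivativeI_sandwich[of 1])
    have "(M \<longlongrightarrow> M x) (at x within {0..1})"
      using primitive01_continuous[OF Mp] x by (auto simp: continuous_on_def)
    then have "((\<lambda>y. 2 * L * B * \<bar>M y - M x\<bar>) \<longlongrightarrow> 2 * L * B * \<bar>M x - M x\<bar>) (at x within {0..1})"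
      by (intro tendsto_intros)
    then show "((\<lambda>y. 2 * L * B * \<bar>M y - M x\<bar>) \<longlongrightarrow> 0) (at x within {0..1})" by simp
    fix y assume y: "y \<in> {0..1}" "y \<noteq> x"
    have "norm (\<Phi> y - \<Phi> x) \<le> \<bar>y - x\<bar> * (2 * L * B * \<bar>M y - M x\<bar>)"
    proof (cases "x \<le> y")
      case True
      have "norm (\<Phi> y - \<Phi> x) \<le> (y - x) * (2 * L * B * (M y - M x))"
        using est[of x y] x y True by auto
      also have "\<dots> \<le> (y - x) * (2 * L * B * \<bar>M y - M x\<bar>)"
        using True L(1) B(1) by (intro mult_left_mono) auto
      finally show ?thesis using True by simp
    next
      case False
      have "norm (\<Phi> y - \<Phi> x) \<le> (x - y) * (2 * L * B * (M x - M y))"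
        using est[of y x] x y False by (auto simp: norm_minus_commute)
      also have "\<dots> \<le> (x - y) * (2 * L * B * \<bar>M y - M x\<bar>)"
        using False L(1) B(1) by (intro mult_left_mono) auto
      finally show ?thesis using False by simp
    qed
    then show "norm (\<Phi> y - \<Phi> x - (y - x) *\<^sub>R 0) / norm (y - x) \<le> 2 * L * B * \<bar>M y - M x\<bar>"
      using y by (simp add: field_simps)
  qed auto
  then obtain C where C: "\<And>x. x \<in> {0..1} \<Longrightarrow> \<Phi> x = C"
    using has_vector_derivative_zero_constant[of "{0..1::real}" \<Phi>] by auto
  show ?thesis
    unfolding primitive01_def
  proof (intro conjI ballI gint)
    fix x :: real assume "x \<in> {0..1}"
    then have "\<Phi> x = \<Phi> 0" using C[of x] C[of 0] by simp
    then show "integral {0..x} ?g = prod (K x) (F x) - prod (K 0) (F 0)"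
      by (simp add: \<Phi>_def algebra_simps)
  qed
qed

text \<open>The set function given by integrating \<open>f\<close> over A vanishes for half-lines,
  which are stable under intersection and generate the Borel sets; a Dynkin argument extends this to
  all Borel sets, null sets to all Lebesgue sets, and then \<open>f\<close> and 0 are densities of
  the same measure.\<close>

lemma primitive01_zero_AE:
  fixes f :: "real \<Rightarrow> 'a::euclidean_space"
  assumes "f absolutely_integrable_on {0..1}" and zero: "\<And>x. x \<in> {0..1} \<Longrightarrow> integral {0..x} f = 0"
  shows "AE x in lebesgue_on {0..1}. f x = 0"
proof -
  define M where "M = lebesgue_on {0..1::real}"
  have intM: "integrable M f"
    unfolding M_def by (rule absolutely_integrable_imp_integrable) (use assms in auto)
  have sI: "set_integrable M A f" if "A \<in> sets M" for A
    using integrable_mult_indicator[OF that intM] by (simp add: set_integrable_def)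
  have spM: "space M = {0..1}" by (simp add: M_def)
  have borelM: "A \<inter> {0..1} \<in> sets M" if "A \<in> sets borel" for A
    using that by (simp add: M_def sets_restrict_space_iff)
  have LI: "set_lebesgue_integral M (A \<inter> {0..1}) f = integral A f"
    if "A \<in> sets borel" "A \<subseteq> {0..1}" for A
  proof -
    have "set_lebesgue_integral M (A \<inter> {0..1}) f = set_lebesgue_integral lebesgue A f"
      using that unfolding M_def set_lebesgue_integral_def
      by (subst integral_restrict_space)
         (auto simp: indicator_def intro!: Bochner_Integration.integral_cong)
    also have "\<dots> = integral A f"
      by (rule set_lebesgue_integral_eq_integral)
         (rule set_integrable_subset[OF assms(1)], use that in auto)
    finally show ?thesis .
  qed
  have tot: "integral\<^sup>L M f = 0"
  proof -
    have "integral\<^sup>L M f = integral {0..1} f"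
      unfolding M_def by (rule lebesgue_integral_eq_integral) (use intM in \<open>auto simp: M_def\<close>)
    then show ?thesis using zero[of 1] by simp
  qed
  have subset_Pow_UNIV: "range (\<lambda>x::real. {..x}) \<subseteq> Pow UNIV" by auto
  have B: "set_lebesgue_integral M (A \<inter> {0..1}) f = 0" if "A \<in> sets borel" for A
  proof -
    have eqs: "sets borel = sigma_sets UNIV (range (\<lambda>x::real. {..x}))"
      by (subst borel_eq_atMost) simp
    have st: "Int_stable (range (\<lambda>x::real. {..x}))"
      by (auto simp: Int_stable_def min_def intro!: image_eqI[where x="min _ _"])
    have "A \<in> sigma_sets UNIV (range (\<lambda>x::real. {..x}))" using that eqs by simp
    then show ?thesis
    proof (induction rule: sigma_sets_induct_disjoint[OF st subset_Pow_UNIV, consumes 1, case_names basic empty compl union])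
      case (basic A)
      then obtain x where A: "A = {..x}" by auto
      show ?case
      proof (cases "x < 0")
        case True
        then have "A \<inter> {0..1} = {}" using A by auto
        then show ?thesis by (simp add: set_lebesgue_integral_def)
      next
        case False
        then have "A \<inter> {0..1} = {0..min x 1} \<inter> {0..1}" using A by auto
        then show ?thesis using LI[of "{0..min x 1}"] zero[of "min x 1"] False by auto
      qed
    next
      case (compl A)
      then have Ab: "A \<in> sets borel" using eqs by simp
      have "set_lebesgue_integral M ((UNIV - A) \<inter> {0..1}) f = integral\<^sup>L M f - set_lebesgue_integral M (A \<inter> {0..1}) f"
      proof -
        have "set_lebesgue_integral M ((UNIV - A) \<inter> {0..1}) f
            = (LINT x|M. f x - indicat_real (A \<inter> {0..1}) x *\<^sub>R f x)"
          unfolding set_lebesgue_integral_def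
          by (intro Bochner_Integration.integral_cong) (auto simp: spM indicator_def)
        also have "\<dots> = integral\<^sup>L M f - set_lebesgue_integral M (A \<inter> {0..1}) f"
          unfolding set_lebesgue_integral_def
          by (rule Bochner_Integration.integral_diff[OF intM])
             (use sI[OF borelM[OF Ab]] in \<open>simp add: set_integrable_def\<close>)
        finally show ?thesis .
      qed
      then show ?case using compl tot by simp
    next
      case (union A)
      have Ab: "A i \<in> sets borel" for i using union eqs by auto
      have "set_lebesgue_integral M (\<Union>i. A i \<inter> {0..1}) f = (\<Sum>i. set_lebesgue_integral M (A i \<inter> {0..1}) f)"
      proof (rule lebesgue_integral_countable_add)
        show "set_integrable M (\<Union>i. A i \<inter> {0..1}) f"
          by (rule sI, rule sets.countable_UN) (use borelM[OF Ab] in auto)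
        show "A i \<inter> {0..1} \<inter> (A j \<inter> {0..1}) = {}" if "i \<noteq> j" for i j
          using union(1) that by (auto simp: disjoint_family_on_def)
      qed (use borelM[OF Ab] in auto)
      moreover have "(\<Union>i. A i \<inter> {0..1}) = (\<Union>i. A i) \<inter> {0..1}" by auto
      ultimately show ?case using union by simp
    qed (auto simp: set_lebesgue_integral_def)
  qed
  have "AE x in M. f x = 0"
  proof (rule sigma_finite_measure.density_unique_banach[OF _ intM])
    show "sigma_finite_measure M"
      unfolding M_def by (intro finite_measure.axioms(1) finite_measure_lebesgue_on) auto
    fix A assume A: "A \<in> sets M"
    then have Al: "A \<in> sets lebesgue" and sub: "A \<subseteq> {0..1}"
      by (auto simp: M_def sets_restrict_space)
    \<comment> \<open>A Lebesgue set is a Borel set up to a null set, and only Borel sets are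
      reached by the induction above.\<close>
    obtain C T where CT: "A = C \<union> T" "C \<in> sets borel" "negligible T"
    proof -
      obtain C T N where "A = C \<union> T" "T \<subseteq> N" "N \<in> null_sets lborel" "C \<in> sets lborel"
        using sets_completionE[OF Al] by metis
      then show ?thesis
        using that[of C T] by (metis negligible_iff_null_sets negligible_subset null_sets_completionI sets_lborel)
    qed
    show "set_lebesgue_integral M A f = set_lebesgue_integral M A (\<lambda>x. 0)"
    proof -
      have "AE x in M. x \<notin> T"
        using CT(3) unfolding M_def
        by (subst AE_restrict_space_iff) (auto simp: negligible_iff_null_sets AE_not_in intro: AE_mp[OF AE_not_in])
      then have "set_lebesgue_integral M A f = set_lebesgue_integral M (C \<inter> {0..1}) f"
        unfolding set_lebesgue_integral_def
      proof (intro integral_cong_AE)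
        show "AE x in M. x \<notin> T \<Longrightarrow> AE x in M. indicat_real A x *\<^sub>R f x = indicat_real (C \<inter> {0..1}) x *\<^sub>R f x"
          by (elim AE_mp, rule AE_I2) (use CT sub in \<open>auto simp: indicator_def\<close>)
      qed (use sI[OF A] sI[OF borelM[OF CT(2)]] in \<open>auto simp: set_integrable_def\<close>)
      then show ?thesis using B[OF CT(2)] by (simp add: set_lebesgue_integral_def)
    qed
  qed auto
  then show ?thesis unfolding M_def .
qed

section \<open>Test functions and the du Bois-Reymond lemma\<close>

definition smooth :: "(real \<Rightarrow> real) \<Rightarrow> bool" where
  "smooth f \<longleftrightarrow> (\<forall>n x. (deriv ^^ n) f differentiable (at x))"

lemma smooth_if_derivative_smooth:
  assumes "\<And>x. (f has_real_derivative f' x) (at x)" "smooth f'"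
  shows "smooth f"
proof -
  have d: "deriv f = f'" using assms(1) DERIV_imp_deriv by blast
  have "(deriv ^^ n) f differentiable (at x)" for n x
  proof (cases n)
    case 0 then show ?thesis
      using assms(1) by (auto simp: differentiable_def has_field_derivative_def)
  next
    case (Suc m)
    then have "(deriv ^^ n) f = (deriv ^^ m) f'" by (simp add: funpow_Suc_right d del: funpow.simps)
    then show ?thesis using assms(2) by (simp add: smooth_def)
  qed
  then show ?thesis by (simp add: smooth_def)
qed

text \<open>A class closed under differentiation contains all iterated derivatives of its members;
  this takes the place of a formula for the n-th derivative.\<close>

lemma smooth_coinduct:
  assumes "f \<in> X" and "\<And>f. f \<in> X \<Longrightarrow> \<exists>f'\<in>X. \<forall>x. (f has_real_derivative f' x) (at x)"
  shows "smooth f"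
proof -
  have X: "(deriv ^^ n) f \<in> X" for n
  proof (induction n)
    case (Suc n)
    then obtain f' where "f' \<in> X" "\<forall>x. ((deriv ^^ n) f has_real_derivative f' x) (at x)"
      using assms(2) by blast
    moreover from this have "deriv ((deriv ^^ n) f) = f'" using DERIV_imp_deriv by blast
    ultimately show ?case by simp
  qed (use assms in simp)
  show ?thesis unfolding smooth_def
  proof (intro allI)
    fix n x
    obtain f' where "\<forall>x. ((deriv ^^ n) f has_real_derivative f' x) (at x)"
      using assms(2)[OF X] by blast
    then show "(deriv ^^ n) f differentiable (at x)"
      by (auto simp: differentiable_def has_field_derivative_def)
  qed
qed

lemma smooth_has_derivative:
  assumes "smooth f" shows "(f has_real_derivative deriv f x) (at x)"
proof -
  have "(deriv ^^ 0) f differentiable (at x)" using assms unfolding smooth_def by blast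
  then show ?thesis by (simp add: DERIV_deriv_iff_real_differentiable)
qed

lemma smooth_deriv: "smooth f \<Longrightarrow> smooth (deriv f)"
  unfolding smooth_def by (metis funpow_Suc_right o_apply)

lemma smooth_continuous: "smooth f \<Longrightarrow> continuous_on S f"
  by (meson DERIV_continuous_on smooth_has_derivative has_field_derivative_at_within)

section \<open>Flat functions and smooth bumps\<close>

definition flat :: "real poly \<Rightarrow> real \<Rightarrow> real" where
  "flat p x = (if x > 0 then poly p (inverse x) * exp (- inverse x) else 0)"

lemma poly_times_exp_neg_tendsto_0: "((\<lambda>y. poly p y * exp (-y)) \<longlongrightarrow> (0::real)) at_top"
proof -
  have "((\<lambda>y. coeff p i * (y ^ i / exp y)) \<longlongrightarrow> coeff p i * 0) at_top" for i
    by (intro tendsto_intros tendsto_power_div_exp_0)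
  then have "((\<lambda>y. \<Sum>i\<le>degree p. coeff p i * (y ^ i / exp y)) \<longlongrightarrow> (\<Sum>i\<le>degree p. 0)) at_top"
    by (intro tendsto_sum) simp
  then show ?thesis
    by (simp add: poly_altdef sum_divide_distrib exp_minus field_simps)
qed

text \<open>In the variable y = 1/x, differentiation by x is - y^2 times differentiation by y, and
  it sends p(y) exp(-y) to y^2 (p - p')(y) exp(-y). The family indexed by polynomials is therefore
  closed under differentiation, also at 0, where exponential decay wins.\<close>

lemma flat_has_derivative:
  "(flat p has_real_derivative flat ([:0,0,1:] * (p - pderiv p)) x) (at x)"
proof -
  consider "x > 0" | "x < 0" | "x = 0" by linarith
  then show ?thesis
  proof cases
    case 1
    have "((\<lambda>x. poly p (inverse x) * exp (- inverse x)) has_real_derivative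
        flat ([:0,0,1:] * (p - pderiv p)) x) (at x)"
      using 1 by (auto intro!: derivative_eq_intros DERIV_chain'[OF _ poly_DERIV]
          simp: flat_def algebra_simps power2_eq_square)
    moreover have "\<forall>\<^sub>F y in nhds x. flat p y = poly p (inverse y) * exp (- inverse y)"
      using eventually_nhds_in_open[of "{0<..}" x] 1 by (auto simp: flat_def elim: eventually_mono)
    ultimately show ?thesis by (subst DERIV_cong_ev[OF refl _ refl])
  next
    case 2
    have "((\<lambda>x. 0) has_real_derivative flat ([:0,0,1:] * (p - pderiv p)) x) (at x)"
      using 2 by (simp add: flat_def)
    moreover have "\<forall>\<^sub>F y in nhds x. flat p y = 0"
      using eventually_nhds_in_open[of "{..<0}" x] 2 by (auto simp: flat_def elim: eventually_mono)
    ultimately show ?thesis by (subst DERIV_cong_ev[OF refl _ refl])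
  next
    case 3
    \<comment> \<open>Dividing by \<open>h\<close> in the difference quotient at 0 amounts to one
      more factor y in the polynomial.\<close>
    have "((\<lambda>h. poly ([:0,1:] * p) (inverse h) * exp (- inverse h)) \<longlongrightarrow> 0) (at_right 0)"
      by (rule filterlim_compose[OF poly_times_exp_neg_tendsto_0 filterlim_inverse_at_top_right])
    then have "((\<lambda>h. flat p h / h) \<longlongrightarrow> 0) (at_right 0)"
      by (rule Lim_transform_eventually)
         (auto simp: eventually_at_right_less flat_def field_simps intro!: eventually_mono[OF eventually_at_right_less[of 0]])
    moreover have "((\<lambda>h. flat p h / h) \<longlongrightarrow> 0) (at_left 0)"
      by (rule Lim_transform_eventually[OF tendsto_const])
         (auto simp: flat_def eventually_at_filter)
    ultimately have "((\<lambda>h. flat p h / h) \<longlongrightarrow> 0) (at 0)"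
      by (simp add: filterlim_split_at)
    then show ?thesis using 3 by (simp add: DERIV_def flat_def)
  qed
qed

text \<open>Affine arguments place the flat point at either end of an interval, products cut off on
  both sides, and sums are what the product rule asks for.\<close>

inductive_set flat_algebra :: "(real \<Rightarrow> real) set" where
  base: "(\<lambda>x. flat p (c * x + b)) \<in> flat_algebra"
| add: "f \<in> flat_algebra \<Longrightarrow> g \<in> flat_algebra \<Longrightarrow> (\<lambda>x. f x + g x) \<in> flat_algebra"
| mult: "f \<in> flat_algebra \<Longrightarrow> g \<in> flat_algebra \<Longrightarrow> (\<lambda>x. f x * g x) \<in> flat_algebra"

lemma flat_algebra_derivative:
  "f \<in> flat_algebra \<Longrightarrow> \<exists>f'\<in>flat_algebra. \<forall>x. (f has_real_derivative f' x) (at x)"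
proof (induction rule: flat_algebra.induct)
  case (base p c b)
  let ?q = "smult c ([:0,0,1:] * (p - pderiv p))"
  have "((\<lambda>x. flat p (c * x + b)) has_real_derivative flat ?q (c * x + b)) (at x)" for x
  proof -
    have "((\<lambda>x. flat p (c * x + b)) has_real_derivative flat ([:0,0,1:] * (p - pderiv p)) (c * x + b) * c) (at x)"
      by (rule DERIV_chain2[OF flat_has_derivative]) (auto intro!: derivative_eq_intros)
    then show ?thesis by (simp add: flat_def mult_ac split: if_splits)
  qed
  then show ?case by (intro bexI[of _ "\<lambda>x. flat ?q (c * x + b)"] allI flat_algebra.base)
next
  case (add f g)
  then obtain f' g' where "f' \<in> flat_algebra" "g' \<in> flat_algebra"
    "\<And>x. (f has_real_derivative f' x) (at x)" "\<And>x. (g has_real_derivative g' x) (at x)" by blast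
  then show ?case
    by (intro bexI[of _ "\<lambda>x. f' x + g' x"] allI DERIV_add flat_algebra.add) auto
next
  case (mult f g)
  then obtain f' g' where fg: "f' \<in> flat_algebra" "g' \<in> flat_algebra"
    "\<And>x. (f has_real_derivative f' x) (at x)" "\<And>x. (g has_real_derivative g' x) (at x)" by blast
  have "((\<lambda>x. f x * g x) has_real_derivative f' x * g x + g' x * f x) (at x)" for x
    by (rule DERIV_mult) (use fg in auto)
  then show ?case
    using fg mult by (intro bexI[of _ "\<lambda>x. f' x * g x + g' x * f x"] allI flat_algebra.add flat_algebra.mult)
qed

lemma smooth_bump_exists:
  fixes a b :: real
  assumes "a < b"
  obtains \<eta> where "smooth \<eta>" "\<And>x. \<eta> x \<ge> 0" "\<And>x. x \<notin> {a<..<b} \<Longrightarrow> \<eta> x = 0"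
    "integral {a..b} \<eta> = 1"
proof -
  define \<beta> where "\<beta> x = flat 1 (1 * x + (-a)) * flat 1 ((-1) * x + b)" for x
  \<comment> \<open>The normalising constant is absorbed into the polynomial, so that the scaled
    bump stays in the algebra.\<close>
  have mem: "(\<lambda>x. c * \<beta> x) \<in> flat_algebra" for c
  proof -
    have "(\<lambda>x. flat [:c:] (1 * x + (-a)) * flat 1 ((-1) * x + b)) \<in> flat_algebra"
      by (intro flat_algebra.mult flat_algebra.base)
    moreover have "(\<lambda>x. flat [:c:] (1 * x + (-a)) * flat 1 ((-1) * x + b)) = (\<lambda>x. c * \<beta> x)"
      by (auto simp: \<beta>_def flat_def fun_eq_iff)
    ultimately show ?thesis by simp
  qed
  have sm: "smooth (\<lambda>x. c * \<beta> x)" for c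
    by (rule smooth_coinduct[OF mem]) (rule flat_algebra_derivative)
  have cont: "continuous_on S \<beta>" for S using smooth_continuous[OF sm[of 1]] by simp
  have pos: "\<beta> x > 0" if "x \<in> {a<..<b}" for x using that by (auto simp: \<beta>_def flat_def)
  have nonneg: "\<beta> x \<ge> 0" for x by (auto simp: \<beta>_def flat_def)
  have zero: "\<beta> x = 0" if "x \<notin> {a<..<b}" for x using that by (auto simp: \<beta>_def flat_def)
  have int: "\<beta> integrable_on {a..b}" by (rule integrable_continuous_real[OF cont])
  have "integral {a..b} \<beta> \<noteq> 0"
  proof
    assume "integral {a..b} \<beta> = 0"
    then have "(\<beta> has_integral 0) (cbox a b)" using int by (auto simp: has_integral_iff)
    then have "\<beta> ((a + b) / 2) = 0"
      by (intro has_integral_0_cbox_imp_0[OF cont]) (use nonneg assms in auto)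
    moreover have "\<beta> ((a + b) / 2) > 0" by (rule pos) (use assms in auto)
    ultimately show False by simp
  qed
  moreover have "integral {a..b} \<beta> \<ge> 0" by (rule integral_nonneg[OF int]) (use nonneg in auto)
  ultimately have I: "integral {a..b} \<beta> > 0" by simp
  show ?thesis
    by (rule that[of "\<lambda>x. inverse (integral {a..b} \<beta>) * \<beta> x"])
       (use sm zero nonneg I in auto)
qed

lemma smooth_diff:
  assumes "smooth f" "smooth g" shows "smooth (\<lambda>x. f x - g x)"
proof (rule smooth_coinduct[of _ "{\<lambda>x. f x - g x |f g. smooth f \<and> smooth g}"])
  fix h assume "h \<in> {\<lambda>x. f x - g x |f g. smooth f \<and> smooth g}"
  then obtain f g where "h = (\<lambda>x. f x - g x)" "smooth f" "smooth g" by blast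
  then show "\<exists>h'\<in>{\<lambda>x. f x - g x |f g. smooth f \<and> smooth g}. \<forall>x. (h has_real_derivative h' x) (at x)"
    by (intro bexI[of _ "\<lambda>x. deriv f x - deriv g x"]) (auto intro!: DERIV_diff smooth_has_derivative intro: smooth_deriv)
qed (use assms in blast)

section \<open>Test functions and integration by parts\<close>

lemma test_function_iff:
  "test_function \<psi> \<longleftrightarrow> smooth \<psi> \<and> closure {x. \<psi> x \<noteq> 0} \<subseteq> {0<..<1}"
  by (simp add: test_function_def smooth_def)

lemma test_function_eq_0:
  assumes "test_function \<psi>" "x \<notin> {0<..<1}"
  shows "\<psi> x = 0"
  using assms closure_subset[of "{x. \<psi> x \<noteq> 0}"] by (auto simp: test_function_iff)

lemma test_functionI:
  assumes "smooth \<psi>" "0 < a" "b < 1" "\<And>x. x \<notin> {a..b} \<Longrightarrow> \<psi> x = 0"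
  shows "test_function \<psi>"
proof -
  have "closure {x. \<psi> x \<noteq> 0} \<subseteq> {a..b}"
    by (rule closure_minimal) (use assms(4) in blast, auto)
  then show ?thesis using assms by (force simp: test_function_iff)
qed

text \<open>Off its closed support the function vanishes on a whole neighbourhood, so
  differentiation does not enlarge the support.\<close>

lemma deriv_test_function:
  assumes "test_function \<psi>" shows "test_function (deriv \<psi>)"
proof -
  have sm: "smooth \<psi>" using assms by (simp add: test_function_iff)
  have "deriv \<psi> x = 0" if "x \<notin> closure {x. \<psi> x \<noteq> 0}" for x
  proof -
    have "\<forall>\<^sub>F y in nhds x. \<psi> y = 0"
      using eventually_nhds_in_open[of "- closure {x. \<psi> x \<noteq> 0}" x] that
      by (auto simp: closed_def[symmetric] elim!: eventually_mono) (metis (mono_tags) closure_subset mem_Collect_eq subsetD)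
    then have "(\<psi> has_real_derivative 0) (at x) \<longleftrightarrow> ((\<lambda>x. 0) has_real_derivative 0) (at x)"
      by (intro DERIV_cong_ev) auto
    then show ?thesis by (auto intro: DERIV_imp_deriv)
  qed
  then have "closure {x. deriv \<psi> x \<noteq> 0} \<subseteq> closure {x. \<psi> x \<noteq> 0}"
    by (intro closure_minimal) auto
  then show ?thesis using assms smooth_deriv[OF sm] by (auto simp: test_function_iff)
qed

text \<open>\<open>F\<close> is only absolutely continuous, which is why the product rule comes from
  \<open>primitive01_bilinear\<close>; the boundary terms vanish because \<psi> is zero at 0 and
  1.\<close>

lemma test_function_integral_by_parts:
  fixes F :: "real \<Rightarrow> 'a::euclidean_space"
  assumes "test_function \<psi>" "primitive01 F f"
  shows "integral {0..1} (\<lambda>x. deriv \<psi> x *\<^sub>R F x) = - integral {0..1} (\<lambda>x. \<psi> x *\<^sub>R f x)"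
proof -
  have sm: "smooth \<psi>" using assms by (simp add: test_function_iff)
  have P: "primitive01 (\<lambda>x. \<psi> x *\<^sub>R F x) (\<lambda>x. deriv \<psi> x *\<^sub>R F x + \<psi> x *\<^sub>R f x)"
    by (rule primitive01_bilinear[OF bounded_bilinear_scaleR])
       (use assms smooth_has_derivative[OF sm] smooth_continuous[OF smooth_deriv[OF sm]] in
         \<open>auto simp: has_real_derivative_iff_has_vector_derivative intro: has_vector_derivative_at_within\<close>)
  have "integral {0..1} (\<lambda>x. deriv \<psi> x *\<^sub>R F x + \<psi> x *\<^sub>R f x) = 0"
    using primitive01_diff[OF P, of 0 1] test_function_eq_0[OF assms(1)] by simp
  moreover have "(\<lambda>x. deriv \<psi> x *\<^sub>R F x) integrable_on {0..1}"
    by (intro integrable_continuous_real continuous_intros smooth_continuous smooth_deriv sm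
        primitive01_continuous[OF assms(2)])
  moreover have "(\<lambda>x. \<psi> x *\<^sub>R f x) integrable_on {0..1}"
    using Henstock_Kurzweil_Integration.integrable_diff[OF primitive01_integrable_sub(2)[OF P, of 0 1] calculation(2)] by simp
  ultimately show ?thesis
    by (simp add: Henstock_Kurzweil_Integration.integral_add eq_neg_iff_add_eq_0)
qed

text \<open>The difference of two unit bumps is the derivative of a test function.\<close>

lemma du_Bois_Reymond:
  fixes w :: "real \<Rightarrow> 'a::euclidean_space"
  assumes cont: "continuous_on {0..1} w"
    and zero: "\<And>\<psi>. test_function \<psi> \<Longrightarrow> integral {0..1} (\<lambda>x. deriv \<psi> x *\<^sub>R w x) = 0"
  shows "w constant_on {0..1}"
proof -
  \<comment> \<open>A unit bump concentrated near \<open>p\<close> averages \<open>w\<close> to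
    within \<open>e\<close> of \<open>w p\<close>, by continuity at \<open>p\<close>.\<close>
  have avg: "\<exists>\<eta> a b. 0 < a \<and> a < b \<and> b < 1 \<and> smooth \<eta> \<and> (\<forall>x. x \<notin> {a<..<b} \<longrightarrow> \<eta> x = 0) \<and>
      integral {0..1} \<eta> = 1 \<and> norm (integral {0..1} (\<lambda>x. \<eta> x *\<^sub>R w x) - w p) \<le> e"
    if p: "p \<in> {0<..<1}" and e: "e > 0" for p e
  proof -
    have "isCont w p"
      using continuous_on_interior[OF cont] p by simp
    then obtain d where d: "d > 0" "\<And>x. dist x p < d \<Longrightarrow> dist (w x) (w p) < e"
      using e unfolding continuous_at_eps_delta by blast
    \<comment> \<open>The halves keep the closed interval from \<open>a\<close> to \<open>b\<close>
      strictly inside (0,1) and within distance d of \<open>p\<close>.\<close>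
    define a where "a = max (p - d/2) (p/2)"
    define b where "b = min (p + d/2) ((1 + p)/2)"
    have ab: "0 < a" "a < p" "p < b" "b < 1" using p d unfolding a_def b_def by (simp_all add: min_less_iff_disj less_max_iff_disj)
    then obtain \<eta> where \<eta>: "smooth \<eta>" "\<And>x. \<eta> x \<ge> 0" "\<And>x. x \<notin> {a<..<b} \<Longrightarrow> \<eta> x = 0"
      "integral {a..b} \<eta> = 1" using smooth_bump_exists[of a b] by auto
    have I: "integral {0..1} \<eta> = 1"
    proof (rule integral_unique, rule has_integral_on_superset)
      show "(\<eta> has_integral 1) {a..b}"
        using \<eta>(4) integrable_continuous_real[OF smooth_continuous[OF \<eta>(1)], of a b]
        by (simp add: has_integral_iff)
      show "{a..b} \<subseteq> {0..1}" using ab by auto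
      show "\<eta> x = 0" if "x \<notin> {a..b}" for x using \<eta>(3)[of x] that by auto
    qed
    have ci: "(\<lambda>x. \<eta> x *\<^sub>R w x) integrable_on {0..1}" "(\<lambda>x. \<eta> x *\<^sub>R w p) integrable_on {0..1}"
       "(\<lambda>x. \<eta> x * e) integrable_on {0..1}" "\<eta> integrable_on {0..1}"
      by (intro integrable_continuous_real continuous_intros smooth_continuous \<eta> cont)+
    have "w p = integral {0..1} (\<lambda>x. \<eta> x *\<^sub>R w p)"
      using integral_linear[OF ci(4) bounded_linear_scaleR_left[of "w p"]] I by (simp add: o_def)
    then have "norm (integral {0..1} (\<lambda>x. \<eta> x *\<^sub>R w x) - w p)
        = norm (integral {0..1} (\<lambda>x. \<eta> x *\<^sub>R w x - \<eta> x *\<^sub>R w p))"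
      using Henstock_Kurzweil_Integration.integral_diff[OF ci(1,2)] by metis
    also have "\<dots> \<le> integral {0..1} (\<lambda>x. \<eta> x * e)"
    proof (rule Henstock_Kurzweil_Integration.integral_norm_bound_integral)
      show "(\<lambda>x. \<eta> x *\<^sub>R w x - \<eta> x *\<^sub>R w p) integrable_on {0..1}"
        using ci by (intro Henstock_Kurzweil_Integration.integrable_diff)
      fix x :: real
      show "norm (\<eta> x *\<^sub>R w x - \<eta> x *\<^sub>R w p) \<le> \<eta> x * e"
      proof (cases "x \<in> {a<..<b}")
        case True
        then have "dist x p < d" using d by (auto simp: a_def b_def dist_real_def)
        then have "norm (w x - w p) \<le> e" using d(2)[of x] by (simp add: dist_norm)
        then show ?thesis
          using \<eta>(2)[of x] by (simp add: scaleR_diff_right[symmetric] mult_left_mono)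
      qed (use \<eta>(3) in simp)
    qed (use ci in auto)
    also have "\<dots> = e" using I by simp
    finally show ?thesis using ab \<eta> I by (intro exI[of _ \<eta>] exI[of _ a] exI[of _ b]) auto
  qed
  have eq: "w p = w q" if pq: "p \<in> {0<..<1}" "q \<in> {0<..<1}" for p q
  proof -
    have "norm (w p - w q) \<le> 0 + e" if e: "e > 0" for e
    proof -
      obtain \<eta> a b where \<eta>: "0 < a" "a < b" "b < 1" "smooth \<eta>" "\<And>x. x \<notin> {a<..<b} \<Longrightarrow> \<eta> x = 0"
        "integral {0..1} \<eta> = 1" "norm (integral {0..1} (\<lambda>x. \<eta> x *\<^sub>R w x) - w p) \<le> e/2"
        using avg[OF pq(1), of "e/2"] e by auto
      obtain \<theta> c d where \<theta>: "0 < c" "c < d" "d < 1" "smooth \<theta>" "\<And>x. x \<notin> {c<..<d} \<Longrightarrow> \<theta> x = 0"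
        "integral {0..1} \<theta> = 1" "norm (integral {0..1} (\<lambda>x. \<theta> x *\<^sub>R w x) - w q) \<le> e/2"
        using avg[OF pq(2), of "e/2"] e by auto
      define \<delta> where "\<delta> x = \<eta> x - \<theta> x" for x
      define l r where "l = min a c" and "r = max b d"
      have lr: "0 < l" "l < r" "r < 1" using \<eta>(1-3) \<theta>(1-3) by (auto simp: l_def r_def)
      have sm: "smooth \<delta>" unfolding \<delta>_def by (intro smooth_diff \<eta> \<theta>)
      have \<delta>0: "\<delta> x = 0" if "x \<notin> {l<..<r}" for x
      proof -
        have "x \<notin> {a<..<b}" "x \<notin> {c<..<d}" using that unfolding l_def r_def by auto
        then show ?thesis using \<eta>(5)[of x] \<theta>(5)[of x] by (simp add: \<delta>_def)
      qed
      have int: "\<delta> integrable_on {x..y}" for x y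
        by (intro integrable_continuous_real smooth_continuous sm)
      have tot: "integral {0..1} \<delta> = 0"
        using \<eta>(6) \<theta>(6) unfolding \<delta>_def
        by (subst Henstock_Kurzweil_Integration.integral_diff)
           (auto intro!: integrable_continuous_real smooth_continuous \<eta>(4) \<theta>(4))
      \<comment> \<open>Starting at -1 leaves room to the left of the supports: every positive point
        is interior to an interval of integration, and for x at most 0 the integral is zero. To the
        right of both supports it vanishes because the two bumps have equal mass.\<close>
      define \<psi> where "\<psi> x = integral {-1..x} \<delta>" for x
      have \<psi>_low: "\<psi> x = 0" if "x \<le> l" for x
      proof -
        have "\<psi> x = integral {-1..x} (\<lambda>x. 0)"
          unfolding \<psi>_def by (rule Henstock_Kurzweil_Integration.integral_cong) (use \<delta>0 that in auto)
        then show ?thesis by simp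
      qed
      have \<psi>_high: "\<psi> x = 0" if "x \<ge> r" for x
      proof -
        have "integral {r..x} \<delta> = 0" if "x \<ge> r" for x
        proof -
          have "integral {r..x} \<delta> = integral {r..x} (\<lambda>x. 0)"
            by (rule Henstock_Kurzweil_Integration.integral_cong) (use \<delta>0 in auto)
          then show ?thesis by simp
        qed
        moreover have "integral {-1..r} \<delta> + integral {r..x} \<delta> = \<psi> x"
          "integral {-1..r} \<delta> + integral {r..1} \<delta> = \<psi> 1"
          "\<psi> 0 + integral {0..1} \<delta> = \<psi> 1"
          unfolding \<psi>_def
          by (rule Henstock_Kurzweil_Integration.integral_combine; use that lr int in auto)+
        ultimately show ?thesis using tot \<psi>_low[of 0] lr that by auto
      qed
      have der: "(\<psi> has_real_derivative \<delta> x) (at x)" for x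
      proof (cases "x > 0")
        case True
        have "(\<psi> has_vector_derivative \<delta> x) (at x within {-1..x+1})"
          unfolding \<psi>_def
          by (rule integral_has_vector_derivative) (use True smooth_continuous[OF sm] in auto)
        moreover have "at x within {-1..x+1} = at x"
          by (rule at_within_interior) (use True in auto)
        ultimately show ?thesis by (simp add: has_real_derivative_iff_has_vector_derivative)
      next
        case False
        have "\<forall>\<^sub>F y in nhds x. \<psi> y = 0"
          using eventually_nhds_in_open[of "{..<l}" x] False lr by (auto intro: \<psi>_low elim!: eventually_mono)
        moreover have "\<delta> x = 0" using \<delta>0 False lr by auto
        ultimately have "(\<psi> has_real_derivative \<delta> x) (at x) \<longleftrightarrow> ((\<lambda>x. 0) has_real_derivative 0) (at x)"
          by (intro DERIV_cong_ev) auto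
        then show ?thesis by simp
      qed
      have "test_function \<psi>"
        by (rule test_functionI[of _ l r]) (use smooth_if_derivative_smooth[OF der sm] lr \<psi>_low \<psi>_high in auto)
      moreover have "deriv \<psi> = \<delta>" using der DERIV_imp_deriv by blast
      ultimately have "integral {0..1} (\<lambda>x. \<delta> x *\<^sub>R w x) = 0" using zero by metis
      moreover have "integral {0..1} (\<lambda>x. \<delta> x *\<^sub>R w x)
         = integral {0..1} (\<lambda>x. \<eta> x *\<^sub>R w x) - integral {0..1} (\<lambda>x. \<theta> x *\<^sub>R w x)"
        unfolding \<delta>_def scaleR_diff_left
        by (intro Henstock_Kurzweil_Integration.integral_diff integrable_continuous_real continuous_intros
            smooth_continuous \<eta>(4) \<theta>(4) cont)
      ultimately have "w p - w q = (integral {0..1} (\<lambda>x. \<theta> x *\<^sub>R w x) - w q)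
          - (integral {0..1} (\<lambda>x. \<eta> x *\<^sub>R w x) - w p)" by simp
      also have "norm \<dots> \<le> e/2 + e/2"
        by (rule order_trans[OF norm_triangle_ineq4 add_mono[OF \<theta>(7) \<eta>(7)]])
      finally show ?thesis by simp
    qed
    then have "norm (w p - w q) \<le> 0" by (rule field_le_epsilon)
    then show ?thesis by simp
  qed
  have "w x = w (1/2)" if "x \<in> {0..1}" for x
  proof (rule continuous_constant_on_closure[of "{0<..<1::real}" w])
    show "continuous_on (closure {0<..<1::real}) w" using cont by simp
    show "w y = w (1/2)" if "y \<in> {0<..<1}" for y using eq[of y "1/2"] that by auto
    show "x \<in> closure {0<..<1::real}" using that by simp
  qed
  then show ?thesis unfolding constant_on_def by blast
qed

section \<open>The domain of the operator\<close>

lemma AE_M01_iff: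
  "(AE x in M01. P x) \<longleftrightarrow> (\<exists>N. negligible N \<and> (\<forall>x\<in>{0<..<1} - N. P x))"
proof -
  have "(AE x in M01. P x) \<longleftrightarrow> (AE x in lebesgue. x \<in> {0<..<1} \<longrightarrow> P x)"
    by (subst AE_restrict_space_iff) auto
  also have "\<dots> \<longleftrightarrow> (\<exists>N. negligible N \<and> (\<forall>x\<in>{0<..<1} - N. P x))"
  proof
    assume "AE x in lebesgue. x \<in> {0<..<1} \<longrightarrow> P x"
    then obtain N where "N \<in> null_sets lebesgue" "{x\<in>space lebesgue. \<not> (x \<in> {0<..<1} \<longrightarrow> P x)} \<subseteq> N"
      by (rule AE_E3) auto
    then show "\<exists>N. negligible N \<and> (\<forall>x\<in>{0<..<1} - N. P x)"
      by (intro exI[of _ N]) (auto simp: negligible_iff_null_sets)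
  next
    assume "\<exists>N. negligible N \<and> (\<forall>x\<in>{0<..<1} - N. P x)"
    then obtain N where "N \<in> null_sets lebesgue" "\<forall>x\<in>{0<..<1} - N. P x"
      by (auto simp: negligible_iff_null_sets)
    then show "AE x in lebesgue. x \<in> {0<..<1} \<longrightarrow> P x"
      by (intro AE_I'[of N]) auto
  qed
  finally show ?thesis .
qed

text \<open>The two endpoints form a null set. This reconciles \<open>L2\<close>, which lives on the
  open interval, with primitives, which live on the closed one.\<close>

lemma eq_ae_iff_negligible:
  "eq_ae f g \<longleftrightarrow> (\<exists>N. negligible N \<and> (\<forall>x\<in>{0..1} - N. f x = g x))"
proof
  assume "eq_ae f g"
  then obtain N where N: "negligible N" "\<forall>x\<in>{0<..<1} - N. f x = g x"
    by (auto simp: eq_ae_def AE_M01_iff)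
  then show "\<exists>N. negligible N \<and> (\<forall>x\<in>{0..1} - N. f x = g x)"
    by (intro exI[of _ "insert 0 (insert 1 N)"]) (auto simp: less_le)
qed (auto simp: eq_ae_def AE_M01_iff)

text \<open>On an interval of finite length square integrability implies integrability, because
  \<open>2 * t \<le> 1 + t^2\<close>.\<close>

lemma L2_integrable:
  assumes "f \<in> L2" shows "f absolutely_integrable_on {0..1}"
proof -
  have m: "f \<in> borel_measurable M01" and i: "integrable M01 (\<lambda>x. (norm (f x))\<^sup>2)"
    using assms by (auto simp: L2_def)
  have "integrable M01 (\<lambda>x. 1 + (norm (f x))\<^sup>2)"
    by (intro Bochner_Integration.integrable_add i finite_measure.integrable_const finite_measure_lebesgue_on) auto
  then have "integrable M01 (norm \<circ> f)"
  proof (rule Bochner_Integration.integrable_bound)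
    show "AE x in M01. norm ((norm \<circ> f) x) \<le> norm (1 + (norm (f x))\<^sup>2)"
    proof (rule AE_I2)
      fix x
      have "norm (f x) * 2 \<le> 1 + (norm (f x))\<^sup>2"
        using zero_le_power2[of "norm (f x) - 1"] by (simp add: power2_diff)
      then show "norm ((norm \<circ> f) x) \<le> norm (1 + (norm (f x))\<^sup>2)" by (simp, smt (verit) norm_ge_zero)
    qed
  qed (use m in \<open>auto simp: o_def\<close>)
  then have "f absolutely_integrable_on {0<..<1}"
    using m by (subst absolutely_integrable_measurable) auto
  then show ?thesis by (simp add: absolutely_integrable_on_Icc_iff_Ioo)
qed

lemma LINT_M01:
  fixes f :: "real \<Rightarrow> 'a::euclidean_space"
  assumes "f absolutely_integrable_on {0..1}"
  shows "(LINT x|M01. f x) = integral {0..1} f" "integrable M01 f"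
proof -
  show i: "integrable M01 f"
    by (rule absolutely_integrable_imp_integrable)
       (use assms in \<open>auto simp: absolutely_integrable_on_Icc_iff_Ioo\<close>)
  have "(LINT x|M01. f x) = integral {0<..<1} f"
    by (rule lebesgue_integral_eq_integral) (use i in auto)
  also have "\<dots> = integral {0..1} f"
    by (simp add: integral_open_interval_real)
  finally show "(LINT x|M01. f x) = integral {0..1} f" .
qed

lemma continuous_imp_L2:
  assumes "continuous_on {0..1} u" shows "u \<in> L2"
proof -
  have "u absolutely_integrable_on {0..1}" by (rule absolutely_integrable_continuous_real) fact
  moreover have "(\<lambda>x. (norm (u x))\<^sup>2) absolutely_integrable_on {0..1}"
    by (rule absolutely_integrable_continuous_real) (intro continuous_intros assms)
  ultimately show ?thesis
    using LINT_M01(2) borel_measurable_integrable[OF LINT_M01(2)] by (auto simp: L2_def)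
qed

lemma L2_add:
  assumes "f \<in> L2" "g \<in> L2" shows "(\<lambda>x. f x + g x) \<in> L2"
proof -
  have m: "f \<in> borel_measurable M01" "g \<in> borel_measurable M01"
    and i: "integrable M01 (\<lambda>x. (norm (f x))\<^sup>2)" "integrable M01 (\<lambda>x. (norm (g x))\<^sup>2)"
    using assms by (auto simp: L2_def)
  have "integrable M01 (\<lambda>x. 2 * (norm (f x))\<^sup>2 + 2 * (norm (g x))\<^sup>2)"
    using i by auto
  then have "integrable M01 (\<lambda>x. (norm (f x + g x))\<^sup>2)"
  proof (rule Bochner_Integration.integrable_bound)
    show "AE x in M01. norm ((norm (f x + g x))\<^sup>2) \<le> norm (2 * (norm (f x))\<^sup>2 + 2 * (norm (g x))\<^sup>2)"
    proof (rule AE_I2)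
      fix x
      have "(norm (f x + g x))\<^sup>2 \<le> (norm (f x) + norm (g x))\<^sup>2"
        by (intro power_mono norm_triangle_ineq) auto
      also have "\<dots> \<le> 2 * (norm (f x))\<^sup>2 + 2 * (norm (g x))\<^sup>2"
        using zero_le_power2[of "norm (f x) - norm (g x)"] by (simp add: power2_diff power2_sum)
      finally show "norm ((norm (f x + g x))\<^sup>2) \<le> norm (2 * (norm (f x))\<^sup>2 + 2 * (norm (g x))\<^sup>2)"
        by simp
    qed
  qed (use m in measurable)
  then show ?thesis using m by (auto simp: L2_def)
qed

lemma L2_linear:
  assumes "f \<in> L2" "bounded_linear h" shows "(\<lambda>x. h (f x)) \<in> L2"
proof -
  have m: "f \<in> borel_measurable M01" and i: "integrable M01 (\<lambda>x. (norm (f x))\<^sup>2)"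
    using assms by (auto simp: L2_def)
  have [measurable]: "h \<in> borel_measurable borel"
    using assms(2) by (intro borel_measurable_continuous_onI linear_continuous_on)
  have m': "(\<lambda>x. h (f x)) \<in> borel_measurable M01"
    using m by measurable
  obtain K where K: "\<And>x. norm (h x) \<le> norm x * K" using bounded_linear.bounded[OF assms(2)] by blast
  have "integrable M01 (\<lambda>x. K\<^sup>2 * (norm (f x))\<^sup>2)" using i by auto
  then have "integrable M01 (\<lambda>x. (norm (h (f x)))\<^sup>2)"
  proof (rule Bochner_Integration.integrable_bound)
    show "AE x in M01. norm ((norm (h (f x)))\<^sup>2) \<le> norm (K\<^sup>2 * (norm (f x))\<^sup>2)"
    proof (rule AE_I2)
      fix x
      have "(norm (h (f x)))\<^sup>2 \<le> (norm (f x) * K)\<^sup>2" by (intro power_mono K) auto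
      then show "norm ((norm (h (f x)))\<^sup>2) \<le> norm (K\<^sup>2 * (norm (f x))\<^sup>2)"
        by (simp add: power_mult_distrib mult_ac)
    qed
  qed (use m' in measurable)
  then show ?thesis using m' by (auto simp: L2_def)
qed

text \<open>Cauchy-Schwarz on an interval of length one, obtained from the nonnegativity of the
  variance of \<open>norm (f x)\<close> about its mean \<open>c\<close>. It converts the L1 bounds
  on Duhamel integrals into the L2 bound required of the resolvent.\<close>

lemma integral_norm_le_L2_norm:
  assumes "f \<in> L2" shows "integral {0..1} (\<lambda>x. norm (f x)) \<le> L2_norm f"
proof -
  have ni: "(\<lambda>x. norm (f x)) absolutely_integrable_on {0..1}"
    using absolutely_integrable_norm[OF L2_integrable[OF assms]] by (simp add: o_def)
  define c where "c = integral {0..1} (\<lambda>x. norm (f x))"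
  have i: "integrable M01 (\<lambda>x. (norm (f x))\<^sup>2)" "integrable M01 (\<lambda>x. norm (f x))"
    using assms LINT_M01(2)[OF ni] by (auto simp: L2_def)
  have c1: "integrable M01 (\<lambda>x. c\<^sup>2)"
    by (intro finite_measure.integrable_const finite_measure_lebesgue_on) auto
  have "0 \<le> (LINT x|M01. (norm (f x) - c)\<^sup>2)"
    by (rule Bochner_Integration.integral_nonneg) auto
  also have "\<dots> = (LINT x|M01. (norm (f x))\<^sup>2 - 2 * c * norm (f x) + c\<^sup>2)"
    by (simp add: power2_diff algebra_simps)
  also have "\<dots> = (LINT x|M01. (norm (f x))\<^sup>2) - 2 * c * (LINT x|M01. norm (f x)) + (LINT x|M01. c\<^sup>2)"
    using i c1 by simp
  also have "(LINT x|M01. c\<^sup>2) = c\<^sup>2"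
    using LINT_M01(1)[of "\<lambda>x. c\<^sup>2"] by simp
  also have "(LINT x|M01. norm (f x)) = c" using LINT_M01(1)[OF ni] by (simp add: c_def)
  finally have "c\<^sup>2 \<le> (LINT x|M01. (norm (f x))\<^sup>2)" by (simp add: power2_eq_square)
  then show ?thesis unfolding c_def[symmetric] L2_norm_def by (rule real_le_rsqrt)
qed

lemma L2_norm_le:
  assumes "continuous_on {0..1} u" "\<And>x. x \<in> {0..1} \<Longrightarrow> norm (u x) \<le> B"
  shows "L2_norm u \<le> B"
proof -
  have B: "B \<ge> 0" using assms(2)[of 0] norm_ge_zero[of "u 0"] by (simp, linarith)
  have "(LINT x|M01. (norm (u x))\<^sup>2) = integral {0..1} (\<lambda>x. (norm (u x))\<^sup>2)"
    by (rule LINT_M01) (intro absolutely_integrable_continuous_real continuous_intros assms)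
  also have "\<dots> \<le> integral {0..1} (\<lambda>x::real. B\<^sup>2)"
    by (rule integral_le) (auto intro!: integrable_continuous_real continuous_intros assms power_mono)
  finally have "(LINT x|M01. (norm (u x))\<^sup>2) \<le> B\<^sup>2" by simp
  then show ?thesis unfolding L2_norm_def using B by (intro real_le_lsqrt) auto
qed

lemma L2_norm_cong_AE:
  assumes "f \<in> L2" "g \<in> L2" "eq_ae f g" shows "L2_norm f = L2_norm g"
  unfolding L2_norm_def
  by (rule arg_cong[of _ _ sqrt], rule integral_cong_AE)
     (use assms in \<open>auto simp: L2_def eq_ae_def elim!: eventually_mono\<close>)

text \<open>Moving one derivative from the test function to each side shows that \<open>u'\<close>
  and the indefinite integral \<open>G\<close> of \<open>g\<close> have the same integrals against
  every \<open>deriv \<psi>\<close>. By du Bois-Reymond their difference is constant, and a constant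
  does not affect primitives.\<close>

lemma primitive01_weak_derivative:
  assumes f: "f \<in> L2" and g: "g \<in> L2" and weak: "has_generalized_deriv2 f g"
    and rep: "C1_representative f u u'"
  shows "primitive01 u' g"
proof -
  have u: "primitive01 u u'" using rep by (intro primitive01_C1) (auto simp: C1_representative_def)
  have cu': "continuous_on {0..1} u'" using rep by (simp add: C1_representative_def)
  define G where "G x = integral {0..x} g" for x
  have G: "primitive01 G g" unfolding G_def by (rule primitive01_integral[OF L2_integrable[OF g]])
  have "(\<lambda>x. u' x - G x) constant_on {0..1}"
  proof (rule du_Bois_Reymond)
    show "continuous_on {0..1} (\<lambda>x. u' x - G x)"
      by (intro continuous_intros cu' primitive01_continuous[OF G])
    fix \<psi> assume \<psi>: "test_function \<psi>"
    have sm: "smooth \<psi>" "smooth (deriv \<psi>)" "smooth (deriv (deriv \<psi>))"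
      using \<psi> smooth_deriv by (auto simp: test_function_iff)
    have pg: "(\<lambda>x. \<psi> x *\<^sub>R g x) absolutely_integrable_on {0..1}"
      by (rule absolutely_integrable_bounded_measurable_product[OF _ _ _ _ L2_integrable[OF g]])
         (auto intro!: continuous_imp_measurable_on_sets_lebesgue smooth_continuous sm
            compact_imp_bounded compact_continuous_image bilinear_conv_bounded_bilinear[THEN iffD2] bounded_bilinear_scaleR)
    have pu: "(\<lambda>x. deriv (deriv \<psi>) x *\<^sub>R u x) absolutely_integrable_on {0..1}"
      by (intro absolutely_integrable_continuous_real continuous_intros smooth_continuous sm
          primitive01_continuous[OF u])
    have "(LINT x|M01. deriv (deriv \<psi>) x *\<^sub>R f x) = (LINT x|M01. deriv (deriv \<psi>) x *\<^sub>R u x)"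
    proof (rule integral_cong_AE)
      have "deriv (deriv \<psi>) \<in> borel_measurable M01"
        by (rule continuous_imp_measurable_on_sets_lebesgue[OF smooth_continuous[OF sm(3)]]) auto
      then show "(\<lambda>x. deriv (deriv \<psi>) x *\<^sub>R f x) \<in> borel_measurable M01"
        using f by (auto simp: L2_def)
      show "(\<lambda>x. deriv (deriv \<psi>) x *\<^sub>R u x) \<in> borel_measurable M01"
        using LINT_M01(2)[OF pu] by auto
      show "AE x in M01. deriv (deriv \<psi>) x *\<^sub>R f x = deriv (deriv \<psi>) x *\<^sub>R u x"
        using rep by (auto simp: C1_representative_def eq_ae_def elim!: eventually_mono)
    qed
    also have "\<dots> = integral {0..1} (\<lambda>x. deriv (deriv \<psi>) x *\<^sub>R u x)" by (rule LINT_M01[OF pu])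
    also have "\<dots> = - integral {0..1} (\<lambda>x. deriv \<psi> x *\<^sub>R u' x)"
      by (rule test_function_integral_by_parts[OF deriv_test_function[OF \<psi>] u])
    finally have 1: "(LINT x|M01. deriv (deriv \<psi>) x *\<^sub>R f x) = - integral {0..1} (\<lambda>x. deriv \<psi> x *\<^sub>R u' x)" .
    have 2: "(LINT x|M01. \<psi> x *\<^sub>R g x) = - integral {0..1} (\<lambda>x. deriv \<psi> x *\<^sub>R G x)"
      using test_function_integral_by_parts[OF \<psi> G] LINT_M01(1)[OF pg] by simp
    have "integral {0..1} (\<lambda>x. deriv \<psi> x *\<^sub>R (u' x - G x))
        = integral {0..1} (\<lambda>x. deriv \<psi> x *\<^sub>R u' x) - integral {0..1} (\<lambda>x. deriv \<psi> x *\<^sub>R G x)"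
      unfolding scaleR_diff_right
      by (intro Henstock_Kurzweil_Integration.integral_diff integrable_continuous_real continuous_intros
          smooth_continuous sm cu' primitive01_continuous[OF G])
    moreover have "(LINT x|M01. deriv (deriv \<psi>) x *\<^sub>R f x) = (LINT x|M01. \<psi> x *\<^sub>R g x)"
      using weak \<psi> by (simp add: has_generalized_deriv2_def)
    ultimately show "integral {0..1} (\<lambda>x. deriv \<psi> x *\<^sub>R (u' x - G x)) = 0"
      using 1 2 by simp
  qed
  then obtain c where c: "\<And>x. x \<in> {0..1} \<Longrightarrow> u' x = G x + c"
    by (auto simp: constant_on_def algebra_simps)
  have "primitive01 (\<lambda>x. c) (\<lambda>x. 0)" by (rule primitive01_C1) auto
  from primitive01_add[OF G this] show ?thesis
    by (rule primitive01_cong) (use c in auto)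
qed

text \<open>The derivative picked by \<open>SOME\<close> is known only through its weak equation,
  but \<open>primitive01_weak_derivative\<close> applies to every such function.\<close>

lemma Dom_D_E:
  assumes "f \<in> Dom_D"
  obtains u u' where "eq_ae f u" "primitive01 u u'" "primitive01 u' (generalized_deriv2 f)"
    "generalized_deriv2 f \<in> L2" "u 0 $ 1 = 0" "u 1 $ 1 = 0" "u' 0 $ 2 = 0" "u' 1 $ 2 = 0"
proof -
  have f: "f \<in> L2" and ex: "\<exists>g. g \<in> L2 \<and> has_generalized_deriv2 f g"
    using assms by (auto simp: Dom_D_def W22_def)
  have g: "generalized_deriv2 f \<in> L2" "has_generalized_deriv2 f (generalized_deriv2 f)"
    using someI_ex[OF ex] by (auto simp: generalized_deriv2_def)
  obtain u u' where u: "C1_representative f u u'" "u 0 $ 1 = 0" "u 1 $ 1 = 0" "u' 0 $ 2 = 0" "u' 1 $ 2 = 0"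
    using assms by (auto simp: Dom_D_def)
  show ?thesis
  proof (rule that[of u u'])
    show "primitive01 u u'" using u(1) by (intro primitive01_C1) (auto simp: C1_representative_def)
    show "primitive01 u' (generalized_deriv2 f)"
      by (rule primitive01_weak_derivative[OF f g u(1)])
  qed (use u g in \<open>auto simp: C1_representative_def\<close>)
qed

text \<open>Two integrations by parts give the weak equation. The function chosen as
  \<open>generalized_deriv2 u\<close> may differ from \<open>g\<close>, but both have the primitive
  \<open>u'\<close>, so their difference has zero primitive and vanishes almost everywhere.\<close>

lemma Dom_D_I:
  assumes u: "primitive01 u u'" and u': "primitive01 u' g" and g: "g \<in> L2"
    and bc: "u 0 $ 1 = 0" "u 1 $ 1 = 0" "u' 0 $ 2 = 0" "u' 1 $ 2 = 0"
  shows "u \<in> Dom_D" "eq_ae (generalized_deriv2 u) g"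
proof -
  have uL: "u \<in> L2" by (rule continuous_imp_L2[OF primitive01_continuous[OF u]])
  have weak: "has_generalized_deriv2 u g"
    unfolding has_generalized_deriv2_def
  proof (intro allI impI)
    fix \<psi> assume \<psi>: "test_function \<psi>"
    have sm: "smooth \<psi>" "smooth (deriv \<psi>)" "smooth (deriv (deriv \<psi>))"
      using \<psi> smooth_deriv by (auto simp: test_function_iff)
    have pg: "(\<lambda>x. \<psi> x *\<^sub>R g x) absolutely_integrable_on {0..1}"
      by (rule absolutely_integrable_bounded_measurable_product[OF _ _ _ _ L2_integrable[OF g]])
         (auto intro!: continuous_imp_measurable_on_sets_lebesgue smooth_continuous sm
            compact_imp_bounded compact_continuous_image bilinear_conv_bounded_bilinear[THEN iffD2] bounded_bilinear_scaleR)
    have pu: "(\<lambda>x. deriv (deriv \<psi>) x *\<^sub>R u x) absolutely_integrable_on {0..1}"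
      by (intro absolutely_integrable_continuous_real continuous_intros smooth_continuous sm
          primitive01_continuous[OF u])
    show "(LINT x|M01. deriv (deriv \<psi>) x *\<^sub>R u x) = (LINT x|M01. \<psi> x *\<^sub>R g x)"
      using test_function_integral_by_parts[OF deriv_test_function[OF \<psi>] u]
        test_function_integral_by_parts[OF \<psi> u'] LINT_M01(1)[OF pu] LINT_M01(1)[OF pg] by simp
  qed
  have rep: "C1_representative u u u'"
    unfolding C1_representative_def
    using primitive01_has_vector_derivative[OF u primitive01_continuous[OF u']]
      primitive01_continuous[OF u'] by (auto simp: eq_ae_def)
  show "u \<in> Dom_D"
    using uL weak g rep bc by (auto simp: Dom_D_def W22_def)
  have ex: "\<exists>g. g \<in> L2 \<and> has_generalized_deriv2 u g" using weak g by blast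
  have g2: "generalized_deriv2 u \<in> L2" "has_generalized_deriv2 u (generalized_deriv2 u)"
    using someI_ex[OF ex] by (auto simp: generalized_deriv2_def)
  have "primitive01 u' (generalized_deriv2 u)"
    by (rule primitive01_weak_derivative[OF uL g2 rep])
  from primitive01_add[OF this primitive01_linear[OF u' bounded_linear_minus[OF bounded_linear_ident]]]
  have P: "primitive01 (\<lambda>x. 0) (\<lambda>x. generalized_deriv2 u x - g x)" by simp
  have "AE x in lebesgue_on {0..1}. generalized_deriv2 u x - g x = 0"
    by (rule primitive01_zero_AE) (use P in \<open>auto simp: primitive01_def\<close>)
  then have "AE x in lebesgue. x \<in> {0..1} \<longrightarrow> generalized_deriv2 u x = g x"
    by (subst (asm) AE_restrict_space_iff) auto
  then show "eq_ae (generalized_deriv2 u) g"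
    unfolding eq_ae_def by (subst AE_restrict_space_iff) (auto elim: eventually_mono)
qed

section \<open>The triangular system\<close>

text \<open>The reduced system on its own: \<open>k\<close> is the frequency, \<open>s\<close> the
  sign \<sigma> in the boundary conditions, and \<open>2 * t * k^2\<close> the coupling of p into q,
  so that \<open>t\<close> stands for 1/(2m). The factor 2 matches the 2 in the resonance identity
  (x sn)'' = - k^2 x sn + 2 cs.\<close>

locale oscillator =
  fixes k t s :: complex
  assumes k_nonzero: "k \<noteq> 0" and s_square: "s * s = 1"
begin

text \<open>Together with \<open>sn\<close>, the fundamental system of y'' = - k^2 y with identity
  initial data at 0; with the division by \<open>k\<close> in \<open>sn\<close>, the coefficients of
  \<open>cs\<close> and \<open>sn\<close> are the initial value and the initial slope.\<close>

definition cs :: "real \<Rightarrow> complex" where "cs x = cos (k * of_real x)"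
definition sn :: "real \<Rightarrow> complex" where "sn x = sin (k * of_real x) / k"

lemma cs_derivative: "(cs has_vector_derivative - k\<^sup>2 * sn x) (at x within S)"
proof -
  have "((\<lambda>x. cos (k * of_real x)) has_vector_derivative - k\<^sup>2 * sn x) (at x within S)"
    unfolding sn_def using k_nonzero
    by (auto intro!: derivative_eq_intros has_vector_derivative_real_field simp: power2_eq_square)
  then show ?thesis by (simp add: cs_def[abs_def])
qed

lemma sn_derivative: "(sn has_vector_derivative cs x) (at x within S)"
proof -
  have "((\<lambda>x. sin (k * of_real x) / k) has_vector_derivative cs x) (at x within S)"
    unfolding cs_def using k_nonzero
    by (auto intro!: derivative_eq_intros has_vector_derivative_real_field)
  then show ?thesis by (simp add: sn_def[abs_def])
qed

lemma cs_sn_0 [simp]: "cs 0 = 1" "sn 0 = 0"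
  by (auto simp: cs_def sn_def)

lemma cs_continuous [continuous_intros]: "continuous_on S cs"
  by (meson continuous_on_vector_derivative cs_derivative)

lemma sn_continuous [continuous_intros]: "continuous_on S sn"
  by (meson continuous_on_vector_derivative sn_derivative)

lemma pythagoras: "cs x * cs x + k\<^sup>2 * (sn x * sn x) = 1"
  using sin_cos_squared_add[of "k * of_real x"] k_nonzero
  by (simp add: cs_def sn_def power2_eq_square field_simps)

lemma primitive01_cs: "primitive01 cs (\<lambda>x. - k\<^sup>2 * sn x)"
  by (intro primitive01_C1 cs_derivative continuous_intros)

lemma primitive01_sn: "primitive01 sn cs"
  by (intro primitive01_C1 sn_derivative continuous_intros)

lemma primitive01_cs_mult:
  "primitive01 F f \<Longrightarrow> primitive01 (\<lambda>x. cs x * F x) (\<lambda>x. - k\<^sup>2 * sn x * F x + cs x * f x)"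
  by (intro primitive01_bilinear bounded_bilinear_mult cs_derivative continuous_intros)

lemma primitive01_sn_mult:
  "primitive01 F f \<Longrightarrow> primitive01 (\<lambda>x. sn x * F x) (\<lambda>x. cs x * F x + sn x * f x)"
  by (intro primitive01_bilinear bounded_bilinear_mult sn_derivative continuous_intros)

lemma primitive01_cmult:
  "primitive01 F f \<Longrightarrow> primitive01 (\<lambda>x. c * F x) (\<lambda>x. c * f x :: complex)"
  by (rule primitive01_linear[OF _ bounded_linear_mult_right])

lemma integrable_continuous_mult:
  fixes g h :: "real \<Rightarrow> complex"
  assumes "continuous_on {0..1} g" "h absolutely_integrable_on {0..1}"
  shows "(\<lambda>x. g x * h x :: complex) absolutely_integrable_on {0..1}"
  by (rule absolutely_integrable_bounded_measurable_product[where h="(*)", OF _ _ _ _ assms(2)])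
     (auto intro!: continuous_imp_measurable_on_sets_lebesgue assms compact_imp_bounded
        compact_continuous_image bilinear_conv_bounded_bilinear[THEN iffD2] bounded_bilinear_mult)

lemma integrable_cs_sn:
  assumes "h absolutely_integrable_on {0..1}"
  shows "(\<lambda>x. cs x * h x) absolutely_integrable_on {0..1}"
    "(\<lambda>x. sn x * h x) absolutely_integrable_on {0..1}"
  by (intro integrable_continuous_mult assms continuous_intros)+

text \<open>The convolution of \<open>sn (x - r)\<close> with \<open>h r\<close>, expanded by the
  addition theorem. In this form it is built from smooth factors times primitives, which the product
  rule can differentiate for merely integrable \<open>h\<close>.\<close>

definition duhamel :: "(real \<Rightarrow> complex) \<Rightarrow> real \<Rightarrow> complex" where
  "duhamel h x = sn x * integral {0..x} (\<lambda>r. cs r * h r) - cs x * integral {0..x} (\<lambda>r. sn r * h r)"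

definition duhamel' :: "(real \<Rightarrow> complex) \<Rightarrow> real \<Rightarrow> complex" where
  "duhamel' h x = cs x * integral {0..x} (\<lambda>r. cs r * h r) + k\<^sup>2 * (sn x * integral {0..x} (\<lambda>r. sn r * h r))"

lemma duhamel_0 [simp]: "duhamel h 0 = 0" "duhamel' h 0 = 0"
  by (auto simp: duhamel_def duhamel'_def)

lemma primitive01_duhamel:
  assumes h: "h absolutely_integrable_on {0..1}"
  shows "primitive01 (duhamel h) (duhamel' h)"
    "primitive01 (duhamel' h) (\<lambda>x. - k\<^sup>2 * duhamel h x + h x)"
proof -
  let ?C = "\<lambda>x. integral {0..x} (\<lambda>r. cs r * h r)" and ?S = "\<lambda>x. integral {0..x} (\<lambda>r. sn r * h r)"
  have C: "primitive01 ?C (\<lambda>r. cs r * h r)" and S: "primitive01 ?S (\<lambda>r. sn r * h r)"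
    by (intro primitive01_integral integrable_cs_sn h)+
  show "primitive01 (duhamel h) (duhamel' h)"
    by (rule primitive01_cong[OF primitive01_add[OF primitive01_sn_mult[OF C]
            primitive01_cmult[OF primitive01_cs_mult[OF S], of "-1"]]])
       (auto simp: duhamel_def duhamel'_def algebra_simps)
  \<comment> \<open>The inhomogeneity comes out with the coefficient cs^2 + k^2 sn^2, which is 1 by
    \<open>pythagoras\<close>.\<close>
  have eq: "- k\<^sup>2 * duhamel h x + h x
      = (- k\<^sup>2 * sn x * ?C x + cs x * (cs x * h x)) + k\<^sup>2 * (cs x * ?S x + sn x * (sn x * h x))" for x
  proof -
    have "- k\<^sup>2 * duhamel h x + h x * (cs x * cs x + k\<^sup>2 * (sn x * sn x))
      = (- k\<^sup>2 * sn x * ?C x + cs x * (cs x * h x)) + k\<^sup>2 * (cs x * ?S x + sn x * (sn x * h x))"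
      by (simp add: duhamel_def algebra_simps)
    then show ?thesis by (simp only: pythagoras mult_1_right)
  qed
  show "primitive01 (duhamel' h) (\<lambda>x. - k\<^sup>2 * duhamel h x + h x)"
    by (rule primitive01_cong[OF primitive01_add[OF primitive01_cs_mult[OF C]
            primitive01_cmult[OF primitive01_sn_mult[OF S], of "k\<^sup>2"]] eq])
       (simp add: duhamel'_def)
qed

lemma duhamel_continuous:
  assumes "h absolutely_integrable_on {0..1}"
  shows "continuous_on {0..1} (duhamel h)" "continuous_on {0..1} (duhamel' h)"
  using primitive01_duhamel[OF assms] primitive01_continuous by auto

text \<open>The combinations \<open>cs * y - sn * y'\<close> and
  \<open>k^2 * sn * y + cs * y'\<close> undo the homogeneous flow: their derivatives
  \<open>- sn * h\<close> and \<open>cs * h\<close> no longer contain \<open>y\<close>. Integrating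
  them and transforming back by \<open>pythagoras\<close> recovers \<open>y\<close> and
  \<open>y'\<close> from the initial values.\<close>

lemma solution_unique:
  assumes y: "primitive01 y y'" and y': "primitive01 y' y2"
    and eq: "\<And>x. x \<in> {0..1} \<Longrightarrow> y2 x = - k\<^sup>2 * y x + h x" and x: "x \<in> {0..1}"
  shows "y x = y 0 * cs x + y' 0 * sn x + duhamel h x"
    "y' x = - k\<^sup>2 * y 0 * sn x + y' 0 * cs x + duhamel' h x"
proof -
  have P: "primitive01 (\<lambda>x. cs x * y x + (-1) * (sn x * y' x)) (\<lambda>x. (-1) * (sn x * h x))"
    by (rule primitive01_cong[OF primitive01_add[OF primitive01_cs_mult[OF y]
            primitive01_cmult[OF primitive01_sn_mult[OF y'], of "-1"]]])
       (auto simp: eq algebra_simps)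
  have Q: "primitive01 (\<lambda>x. k\<^sup>2 * (sn x * y x) + cs x * y' x) (\<lambda>x. cs x * h x)"
    by (rule primitive01_cong[OF primitive01_add[OF
            primitive01_cmult[OF primitive01_sn_mult[OF y], of "k\<^sup>2"] primitive01_cs_mult[OF y']]])
       (auto simp: eq algebra_simps)
  have A: "cs x * y x - sn x * y' x = y 0 - integral {0..x} (\<lambda>r. sn r * h r)"
    using primitive01_diff[OF P, of 0 x] x by (simp add: algebra_simps)
  have B: "k\<^sup>2 * (sn x * y x) + cs x * y' x = y' 0 + integral {0..x} (\<lambda>r. cs r * h r)"
    using primitive01_diff[OF Q, of 0 x] x by (simp add: algebra_simps)
  have "y x = y x * (cs x * cs x + k\<^sup>2 * (sn x * sn x))" by (simp add: pythagoras)
  also have "\<dots> = cs x * (cs x * y x - sn x * y' x) + sn x * (k\<^sup>2 * (sn x * y x) + cs x * y' x)"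
    by (simp add: algebra_simps)
  finally show "y x = y 0 * cs x + y' 0 * sn x + duhamel h x"
    unfolding A B duhamel_def by (simp add: algebra_simps)
  have "y' x = y' x * (cs x * cs x + k\<^sup>2 * (sn x * sn x))" by (simp add: pythagoras)
  also have "\<dots> = cs x * (k\<^sup>2 * (sn x * y x) + cs x * y' x) - k\<^sup>2 * sn x * (cs x * y x - sn x * y' x)"
    by (simp add: algebra_simps)
  finally show "y' x = - k\<^sup>2 * y 0 * sn x + y' 0 * cs x + duhamel' h x"
    unfolding A B duhamel'_def by (simp add: algebra_simps)
qed

lemma integral_continuous_mult_bound:
  fixes g h :: "real \<Rightarrow> complex"
  assumes g: "continuous_on {0..1} g" "\<And>x. x \<in> {0..1} \<Longrightarrow> norm (g x) \<le> B"
    and h: "h absolutely_integrable_on {0..1}" and x: "x \<in> {0..1}"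
  shows "norm (integral {0..x} (\<lambda>r. g r * h r :: complex)) \<le> B * integral {0..1} (\<lambda>r. norm (h r))"
proof -
  have B: "B \<ge> 0" by (rule order_trans[OF norm_ge_zero g(2)[of 0]]) simp
  have nh: "(\<lambda>r. norm (h r)) absolutely_integrable_on {0..1}"
    using absolutely_integrable_norm[OF h] by (simp add: o_def)
  have sub: "f integrable_on {0..x}" if "f absolutely_integrable_on {0..1}" for f :: "real \<Rightarrow> 'd::euclidean_space"
    using absolutely_integrable_on_subinterval[OF that, of 0 x] x by (auto simp: absolutely_integrable_on_def)
  have nh': "(\<lambda>r. B * norm (h r)) absolutely_integrable_on {0..1}"
    using absolutely_integrable_scaleR_left[OF nh, of B] by simp
  have "norm (integral {0..x} (\<lambda>r. g r * h r)) \<le> integral {0..x} (\<lambda>r. B * norm (h r))"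
    by (rule Henstock_Kurzweil_Integration.integral_norm_bound_integral)
       (use x in \<open>auto intro!: sub integrable_continuous_mult g h nh' mult_right_mono simp: norm_mult\<close>)
  also have "\<dots> \<le> integral {0..1} (\<lambda>r. B * norm (h r))"
    by (rule integral_subset_le) (use x B sub[OF nh'] nh' in \<open>auto simp: absolutely_integrable_on_def\<close>)
  finally show ?thesis by simp
qed

lemma duhamel_bound:
  obtains K where "K \<ge> 0"
    "\<And>h x. h absolutely_integrable_on {0..1} \<Longrightarrow> x \<in> {0..1} \<Longrightarrow> norm (duhamel h x) \<le> K * integral {0..1} (\<lambda>r. norm (h r))"
    "\<And>h x. h absolutely_integrable_on {0..1} \<Longrightarrow> x \<in> {0..1} \<Longrightarrow> norm (duhamel' h x) \<le> K * integral {0..1} (\<lambda>r. norm (h r))"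
proof -
  have "bounded (cs ` {0..1})" "bounded (sn ` {0..1})"
    by (intro compact_imp_bounded compact_continuous_image continuous_intros; simp)+
  then obtain B1 B2 where B12: "\<And>x. x \<in> {0..1} \<Longrightarrow> norm (cs x) \<le> B1" "\<And>x. x \<in> {0..1} \<Longrightarrow> norm (sn x) \<le> B2"
    unfolding bounded_iff by blast
  define B where "B = max 0 (max B1 B2)"
  have B: "B \<ge> 0" "\<And>x. x \<in> {0..1} \<Longrightarrow> norm (cs x) \<le> B" "\<And>x. x \<in> {0..1} \<Longrightarrow> norm (sn x) \<le> B"
    using B12 by (fastforce simp: B_def)+
  define N where "N = (norm k)\<^sup>2"
  have N: "N \<ge> 0" by (simp add: N_def)
  show ?thesis
  \<comment> \<open>One constant dominating both bounds: 2 B^2 for \<open>duhamel\<close> and (1 +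
    N) B^2 for its derivative.\<close>
  proof (rule that[of "B * B + (1 + N) * (B * B)"])
    show "B * B + (1 + N) * (B * B) \<ge> 0" using B(1) N by simp
    fix h :: "real \<Rightarrow> complex" and x :: real assume h: "h absolutely_integrable_on {0..1}" and x: "x \<in> {0..1}"
    define I where "I = integral {0..1} (\<lambda>r. norm (h r))"
    have I: "I \<ge> 0" unfolding I_def
      using absolutely_integrable_norm[OF h] by (intro integral_nonneg) (auto simp: o_def absolutely_integrable_on_def)
    have C: "norm (integral {0..x} (\<lambda>r. cs r * h r)) \<le> B * I"
      and S: "norm (integral {0..x} (\<lambda>r. sn r * h r)) \<le> B * I"
      unfolding I_def by (intro integral_continuous_mult_bound B h x continuous_intros; assumption)+
    have p: "norm (a * b) \<le> B * (B * I)" if "norm a \<le> B" "norm b \<le> B * I" for a b :: complex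
      unfolding norm_mult using that B(1) I by (intro mult_mono) auto
    have "norm (duhamel h x) \<le> B * (B * I) + B * (B * I)"
      unfolding duhamel_def by (rule order_trans[OF norm_triangle_ineq4 add_mono[OF p p]]) (use B x C S in auto)
    also have "\<dots> \<le> B * (B * I) + (1 + N) * (B * (B * I))"
      using N I B(1) by (simp add: algebra_simps)
    finally show "norm (duhamel h x) \<le> (B * B + (1 + N) * (B * B)) * I"
      by (simp add: algebra_simps)
    have "norm (duhamel' h x) \<le> B * (B * I) + N * (B * (B * I))"
      unfolding duhamel'_def
    proof (rule norm_triangle_mono)
      show "norm (cs x * integral {0..x} (\<lambda>r. cs r * h r)) \<le> B * (B * I)"
        by (rule p) (use B x C in auto)
      show "norm (k\<^sup>2 * (sn x * integral {0..x} (\<lambda>r. sn r * h r))) \<le> N * (B * (B * I))"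
        unfolding norm_mult[of "k\<^sup>2"] N_def norm_power
        by (rule mult_left_mono[OF p]) (use B x S in auto)
    qed
    also have "\<dots> \<le> B * (B * I) + (1 + N) * (B * (B * I))"
      using N I B(1) by (simp add: algebra_simps)
    finally show "norm (duhamel' h x) \<le> (B * B + (1 + N) * (B * B)) * I"
      by (simp add: algebra_simps)
  qed
qed

text \<open>Responses of the second equation to \<open>p = cs\<close> and \<open>p = sn\<close>; the factor \<open>x\<close> is the resonance
  caused by the nilpotent part of the matrix.\<close>

definition res0 :: "real \<Rightarrow> complex" where "res0 x = t * k\<^sup>2 * (of_real x * sn x)"
definition res0' :: "real \<Rightarrow> complex" where "res0' x = t * k\<^sup>2 * (sn x + of_real x * cs x)"
definition res1 :: "real \<Rightarrow> complex" where "res1 x = t * (sn x - of_real x * cs x)"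

text \<open>The response to \<open>sn\<close> has the response to \<open>cs\<close> as its
  derivative, just as \<open>cs\<close> is the derivative of \<open>sn\<close>; so
  \<open>res0\<close> and \<open>res0'\<close> also serve as the derivatives of
  \<open>res1\<close>.\<close>

lemma res_derivative:
  "(res0 has_vector_derivative res0' x) (at x within S)"
  "(res0' has_vector_derivative - k\<^sup>2 * res0 x + 2 * t * k\<^sup>2 * cs x) (at x within S)"
  "(res1 has_vector_derivative res0 x) (at x within S)"
  unfolding res0_def[abs_def] res0'_def[abs_def] res1_def[abs_def]
  by (auto intro!: derivative_eq_intros cs_derivative sn_derivative has_vector_derivative_of_real simp: algebra_simps power2_eq_square)

lemma primitive01_res:
  "primitive01 res0 res0'" "primitive01 res0' (\<lambda>x. - k\<^sup>2 * res0 x + 2 * t * k\<^sup>2 * cs x)"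
  "primitive01 res1 res0" "primitive01 res0 (\<lambda>x. - k\<^sup>2 * res1 x + 2 * t * k\<^sup>2 * sn x)"
proof -
  have c: "continuous_on {0..1} res0" "continuous_on {0..1} res0'"
    by (meson continuous_on_vector_derivative res_derivative)+
  show "primitive01 res0 res0'" "primitive01 res1 res0"
    by (intro primitive01_C1 res_derivative c)+
  show "primitive01 res0' (\<lambda>x. - k\<^sup>2 * res0 x + 2 * t * k\<^sup>2 * cs x)"
    by (intro primitive01_C1 res_derivative continuous_intros c)
  have "res0' = (\<lambda>x. - k\<^sup>2 * res1 x + 2 * t * k\<^sup>2 * sn x)"
    by (auto simp: res0'_def res1_def fun_eq_iff algebra_simps)
  then show "primitive01 res0 (\<lambda>x. - k\<^sup>2 * res1 x + 2 * t * k\<^sup>2 * sn x)"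
    using \<open>primitive01 res0 res0'\<close> by simp
qed

lemma res_0 [simp]: "res0 0 = 0" "res0' 0 = 0" "res1 0 = 0"
  by (auto simp: res0_def res0'_def res1_def)

text \<open>What still drives the second equation once the responses to \<open>cs\<close> and
  \<open>sn\<close> are split off: the coupling applied to the particular part of p, and
  \<open>h2\<close>.\<close>

definition forcing :: "(real \<Rightarrow> complex) \<Rightarrow> (real \<Rightarrow> complex) \<Rightarrow> real \<Rightarrow> complex" where
  "forcing h1 h2 x = 2 * t * k\<^sup>2 * duhamel h1 x + h2 x"

definition sol_p where "sol_p p0 p1 h1 x = p0 * cs x + p1 * sn x + duhamel h1 x"
definition sol_p' where "sol_p' p0 p1 h1 x = - k\<^sup>2 * p0 * sn x + p1 * cs x + duhamel' h1 x"
text \<open>The term \<open>s * sn\<close> builds in the conditions at 0, namely q(0) = 0 and q'(0)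
  = s p'(0); the latter is \<gamma>'(0) = 0.\<close>

definition sol_q where
  "sol_q p0 p1 h1 h2 x = p0 * res0 x + p1 * (res1 x + s * sn x) + duhamel (forcing h1 h2) x"
definition sol_q' where
  "sol_q' p0 p1 h1 h2 x = p0 * res0' x + p1 * (res0 x + s * cs x) + duhamel' (forcing h1 h2) x"

lemma forcing_integrable:
  assumes "h1 absolutely_integrable_on {0..1}" "h2 absolutely_integrable_on {0..1}"
  shows "forcing h1 h2 absolutely_integrable_on {0..1}"
proof -
  have "(\<lambda>x. 2 * t * k\<^sup>2 * duhamel h1 x) absolutely_integrable_on {0..1}"
    by (intro absolutely_integrable_continuous_real continuous_intros duhamel_continuous assms)
  then show ?thesis unfolding forcing_def[abs_def] by (intro set_integral_add(1) assms)
qed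

lemma primitive01_sol_p:
  assumes "h1 absolutely_integrable_on {0..1}"
  shows "primitive01 (sol_p p0 p1 h1) (sol_p' p0 p1 h1)"
    "primitive01 (sol_p' p0 p1 h1) (\<lambda>x. - k\<^sup>2 * sol_p p0 p1 h1 x + h1 x)"
proof -
  show "primitive01 (sol_p p0 p1 h1) (sol_p' p0 p1 h1)"
    by (rule primitive01_cong[OF primitive01_add[OF primitive01_add[OF
        primitive01_cmult[OF primitive01_cs, of p0] primitive01_cmult[OF primitive01_sn, of p1]]
        primitive01_duhamel(1)[OF assms]]]) (auto simp: sol_p_def sol_p'_def)
  show "primitive01 (sol_p' p0 p1 h1) (\<lambda>x. - k\<^sup>2 * sol_p p0 p1 h1 x + h1 x)"
    by (rule primitive01_cong[OF primitive01_add[OF primitive01_add[OF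
        primitive01_cmult[OF primitive01_sn, of "- k\<^sup>2 * p0"] primitive01_cmult[OF primitive01_cs, of p1]]
        primitive01_duhamel(2)[OF assms]]]) (auto simp: sol_p_def sol_p'_def algebra_simps)
qed

lemma primitive01_sol_q:
  assumes "h1 absolutely_integrable_on {0..1}" "h2 absolutely_integrable_on {0..1}"
  shows "primitive01 (sol_q p0 p1 h1 h2) (sol_q' p0 p1 h1 h2)"
    "primitive01 (sol_q' p0 p1 h1 h2)
       (\<lambda>x. - k\<^sup>2 * sol_q p0 p1 h1 h2 x + 2 * t * k\<^sup>2 * sol_p p0 p1 h1 x + h2 x)"
proof -
  note F = primitive01_duhamel[OF forcing_integrable[OF assms]]
  show "primitive01 (sol_q p0 p1 h1 h2) (sol_q' p0 p1 h1 h2)"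
    by (rule primitive01_cong[OF primitive01_add[OF primitive01_add[OF
        primitive01_cmult[OF primitive01_res(1), of p0]
        primitive01_cmult[OF primitive01_add[OF primitive01_res(3) primitive01_cmult[OF primitive01_sn, of s]], of p1]]
        F(1)]]) (auto simp: sol_q_def sol_q'_def)
  show "primitive01 (sol_q' p0 p1 h1 h2)
       (\<lambda>x. - k\<^sup>2 * sol_q p0 p1 h1 h2 x + 2 * t * k\<^sup>2 * sol_p p0 p1 h1 x + h2 x)"
    by (rule primitive01_cong[OF primitive01_add[OF primitive01_add[OF
        primitive01_cmult[OF primitive01_res(2), of p0]
        primitive01_cmult[OF primitive01_add[OF primitive01_res(4) primitive01_cmult[OF primitive01_cs, of s]], of p1]]
        F(2)]]) (auto simp: sol_q_def sol_q'_def sol_p_def forcing_def algebra_simps)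
qed

lemma sol_0 [simp]:
  "sol_p p0 p1 h1 0 = p0" "sol_p' p0 p1 h1 0 = p1" "sol_q p0 p1 h1 h2 0 = 0" "sol_q' p0 p1 h1 h2 0 = p1 * s"
  by (auto simp: sol_p_def sol_p'_def sol_q_def sol_q'_def)

lemma system_unique:
  assumes p: "primitive01 p p'" "primitive01 p' p2" "\<And>x. x \<in> {0..1} \<Longrightarrow> p2 x = - k\<^sup>2 * p x + h1 x"
    and q: "primitive01 q q'" "primitive01 q' q2"
      "\<And>x. x \<in> {0..1} \<Longrightarrow> q2 x = - k\<^sup>2 * q x + 2 * t * k\<^sup>2 * p x + h2 x"
    and h: "h1 absolutely_integrable_on {0..1}" "h2 absolutely_integrable_on {0..1}"
    and q0: "q 0 = 0" "q' 0 = s * p' 0" and x: "x \<in> {0..1}"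
  shows "p x = sol_p (p 0) (p' 0) h1 x" "p' x = sol_p' (p 0) (p' 0) h1 x"
    "q x = sol_q (p 0) (p' 0) h1 h2 x" "q' x = sol_q' (p 0) (p' 0) h1 h2 x"
proof -
  have P: "p x = sol_p (p 0) (p' 0) h1 x" "p' x = sol_p' (p 0) (p' 0) h1 x" if "x \<in> {0..1}" for x
    using solution_unique[OF p that] by (auto simp: sol_p_def sol_p'_def)
  show "p x = sol_p (p 0) (p' 0) h1 x" "p' x = sol_p' (p 0) (p' 0) h1 x" by (rule P[OF x])+
  let ?H = "\<lambda>x. 2 * t * k\<^sup>2 * p x + h2 x"
  have Q: "q x = q 0 * cs x + q' 0 * sn x + duhamel ?H x"
     "q' x = - k\<^sup>2 * q 0 * sn x + q' 0 * cs x + duhamel' ?H x"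
    by (rule solution_unique[OF q(1,2) _ x]; use q(3) in \<open>simp add: add_ac\<close>)+
  have eq: "- k\<^sup>2 * sol_q (p 0) (p' 0) h1 h2 r + 2 * t * k\<^sup>2 * sol_p (p 0) (p' 0) h1 r + h2 r
      = - k\<^sup>2 * sol_q (p 0) (p' 0) h1 h2 r + ?H r" if "r \<in> {0..1}" for r
    unfolding P(1)[OF that, symmetric] by (simp only: add.assoc)
  \<comment> \<open>\<open>sol_q\<close> solves the scalar equation with the same force
    \<open>?H\<close> and the same initial values, so comparing the two representations avoids
    computing \<open>duhamel\<close> of the coupling term.\<close>
  have S: "sol_q (p 0) (p' 0) h1 h2 x = (p' 0 * s) * sn x + duhamel ?H x"
     "sol_q' (p 0) (p' 0) h1 h2 x = (p' 0 * s) * cs x + duhamel' ?H x"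
    using solution_unique[OF primitive01_sol_q[OF h] eq x] by simp_all
  have q0': "q' 0 = p' 0 * s" using q0(2) by (simp only: mult.commute)
  show "q x = sol_q (p 0) (p' 0) h1 h2 x" unfolding Q(1) S(1) q0' q0(1) by simp
  show "q' x = sol_q' (p 0) (p' 0) h1 h2 x" unfolding Q(2) S(2) q0' q0(1) by simp
qed

section \<open>The boundary conditions at 1\<close>

definition char_det :: complex where "char_det = s * k\<^sup>2 * (t\<^sup>2 - (t + s)\<^sup>2 * (sn 1)\<^sup>2)"

text \<open>The four entries form the matrix taking (p0, p1) to (\<phi>(1), \<gamma>'(1)) for zero
  right-hand side, where \<phi> = q and \<gamma>' = s q' - p'. In the last entry the
  \<open>cs\<close> terms cancel because s^2 = 1.\<close>

definition m11 where "m11 = res0 1"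
definition m12 where "m12 = res1 1 + s * sn 1"
definition m21 where "m21 = s * res0' 1 + k\<^sup>2 * sn 1"
definition m22 where "m22 = s * res0 1"

text \<open>Since s^2 = 1, the off-diagonal entries are (t + s) sn - t cs and s k^2 ((t + s) sn + t
  cs) at 1. Their product is a difference of squares, whose t^2 cs^2 joins the diagonal product s
  k^2 t^2 k^2 sn^2 to give s k^2 t^2 by \<open>pythagoras\<close>.\<close>

lemma char_det: "m11 * m22 - m12 * m21 = char_det"
proof -
  have c: "cs 1 * cs 1 = 1 - k\<^sup>2 * (sn 1 * sn 1)" using pythagoras[of 1] by (simp add: algebra_simps)
  have s': "s * (s * w) = w" for w using s_square by (simp flip: mult.assoc)
  have "m11 * m22 - m12 * m21 = s * k\<^sup>2 * (t\<^sup>2 * (k\<^sup>2 * (sn 1 * sn 1) + cs 1 * cs 1) - (t + s)\<^sup>2 * (sn 1)\<^sup>2)"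
    unfolding m11_def m12_def m21_def m22_def res0_def res1_def res0'_def
    using s_square by (simp only: of_real_1 mult_1_left) algebra
  also have "\<dots> = char_det" by (simp add: char_det_def c)
  finally show ?thesis .
qed

lemma boundary_1:
  "sol_q p0 p1 h1 h2 1 = m11 * p0 + m12 * p1 + duhamel (forcing h1 h2) 1"
  "s * sol_q' p0 p1 h1 h2 1 - sol_p' p0 p1 h1 1
     = m21 * p0 + m22 * p1 + (s * duhamel' (forcing h1 h2) 1 - duhamel' h1 1)"
proof -
  show "sol_q p0 p1 h1 h2 1 = m11 * p0 + m12 * p1 + duhamel (forcing h1 h2) 1"
    by (simp add: sol_q_def m11_def m12_def mult_ac)
  show "s * sol_q' p0 p1 h1 h2 1 - sol_p' p0 p1 h1 1
     = m21 * p0 + m22 * p1 + (s * duhamel' (forcing h1 h2) 1 - duhamel' h1 1)"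
    unfolding sol_q'_def sol_p'_def m21_def m22_def using s_square by algebra
qed

definition rhs1 where "rhs1 h1 h2 = - duhamel (forcing h1 h2) 1"
definition rhs2 where "rhs2 h1 h2 = - (s * duhamel' (forcing h1 h2) 1 - duhamel' h1 1)"
text \<open>Cramer's rule for the initial data that meet the conditions at 1; \<open>init1\<close>
  is the other unknown.\<close>

definition init0 where "init0 h1 h2 = (m22 * rhs1 h1 h2 - m12 * rhs2 h1 h2) / char_det"
definition init1 where "init1 h1 h2 = (m11 * rhs2 h1 h2 - m21 * rhs1 h1 h2) / char_det"

lemma boundary_1_iff:
  assumes "char_det \<noteq> 0"
  shows "sol_q p0 p1 h1 h2 1 = 0 \<and> s * sol_q' p0 p1 h1 h2 1 = sol_p' p0 p1 h1 1 \<longleftrightarrow>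
    p0 = init0 h1 h2 \<and> p1 = init1 h1 h2"
proof -
  have "sol_q p0 p1 h1 h2 1 = 0 \<and> s * sol_q' p0 p1 h1 h2 1 = sol_p' p0 p1 h1 1 \<longleftrightarrow>
     m11 * p0 + m12 * p1 = rhs1 h1 h2 \<and> m21 * p0 + m22 * p1 = rhs2 h1 h2"
    unfolding boundary_1(1) rhs1_def rhs2_def eq_neg_iff_add_eq_0 boundary_1(2)[symmetric]
    by (simp only: right_minus_eq)
  also have "\<dots> \<longleftrightarrow> char_det * p0 = m22 * rhs1 h1 h2 - m12 * rhs2 h1 h2 \<and>
      char_det * p1 = m11 * rhs2 h1 h2 - m21 * rhs1 h1 h2"
  proof
    assume "m11 * p0 + m12 * p1 = rhs1 h1 h2 \<and> m21 * p0 + m22 * p1 = rhs2 h1 h2"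
    then have E: "rhs1 h1 h2 = m11 * p0 + m12 * p1" "rhs2 h1 h2 = m21 * p0 + m22 * p1" by auto
    have "char_det * p0 = m22 * rhs1 h1 h2 - m12 * rhs2 h1 h2"
      "char_det * p1 = m11 * rhs2 h1 h2 - m21 * rhs1 h1 h2"
      unfolding E char_det[symmetric] by (simp_all add: algebra_simps)
    then show "char_det * p0 = m22 * rhs1 h1 h2 - m12 * rhs2 h1 h2 \<and>
      char_det * p1 = m11 * rhs2 h1 h2 - m21 * rhs1 h1 h2" ..
  next
    assume *: "char_det * p0 = m22 * rhs1 h1 h2 - m12 * rhs2 h1 h2 \<and>
      char_det * p1 = m11 * rhs2 h1 h2 - m21 * rhs1 h1 h2"
    have E: "char_det * (m11 * p0 + m12 * p1) = m11 * (char_det * p0) + m12 * (char_det * p1)"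
      "char_det * (m21 * p0 + m22 * p1) = m21 * (char_det * p0) + m22 * (char_det * p1)"
      by (simp_all add: algebra_simps)
    have "char_det * (m11 * p0 + m12 * p1) = char_det * rhs1 h1 h2"
      "char_det * (m21 * p0 + m22 * p1) = char_det * rhs2 h1 h2"
      unfolding E *[THEN conjunct1] *[THEN conjunct2] unfolding char_det[symmetric]
      by (simp_all add: algebra_simps)
    then show "m11 * p0 + m12 * p1 = rhs1 h1 h2 \<and> m21 * p0 + m22 * p1 = rhs2 h1 h2"
      using assms by simp
  qed
  also have "\<dots> \<longleftrightarrow> p0 = init0 h1 h2 \<and> p1 = init1 h1 h2"
    using assms by (auto simp: init0_def init1_def field_simps)
  finally show ?thesis .
qed

text \<open>A nonzero row of a singular 2 by 2 matrix, with its entries swapped and one sign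
  changed, lies in the kernel; for the zero matrix any vector does.\<close>

lemma singular_kernel:
  assumes "char_det = 0"
  obtains p0 p1 where "(p0, p1) \<noteq> (0, 0)" "m11 * p0 + m12 * p1 = 0" "m21 * p0 + m22 * p1 = 0"
proof -
  have d: "m11 * m22 = m12 * m21" using char_det assms by simp
  show ?thesis
  proof (cases "m11 = 0 \<and> m12 = 0")
    case False
    show ?thesis by (rule that[of m12 "- m11"]) (use False d in \<open>auto simp: mult_ac\<close>)
  next
    case True
    show ?thesis
    proof (cases "m21 = 0 \<and> m22 = 0")
      case False
      show ?thesis by (rule that[of m22 "- m21"]) (use False True in \<open>auto simp: mult_ac\<close>)
    qed (rule that[of 1 0], use True in auto)
  qed
qed

lemma norm_integral_forcing:
  obtains K where "K \<ge> 0"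
    "\<And>h1 h2. h1 absolutely_integrable_on {0..1} \<Longrightarrow> h2 absolutely_integrable_on {0..1} \<Longrightarrow>
       integral {0..1} (\<lambda>x. norm (forcing h1 h2 x)) \<le> 
       K * (integral {0..1} (\<lambda>r. norm (h1 r)) + integral {0..1} (\<lambda>r. norm (h2 r)))"
proof -
  obtain K where K: "K \<ge> 0" "\<And>h x. h absolutely_integrable_on {0..1} \<Longrightarrow> x \<in> {0..1} \<Longrightarrow>
      norm (duhamel h x) \<le> K * integral {0..1} (\<lambda>r. norm (h r))" using duhamel_bound by metis
  define L where "L = norm (2 * t * k\<^sup>2)"
  show ?thesis
  proof (rule that[of "L * K + 1"])
    show "L * K + 1 \<ge> 0" using K by (simp add: L_def)
    fix h1 h2 :: "real \<Rightarrow> complex"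
    assume h: "h1 absolutely_integrable_on {0..1}" "h2 absolutely_integrable_on {0..1}"
    let ?I = "\<lambda>h::real \<Rightarrow> complex. integral {0..1} (\<lambda>r. norm (h r))"
    have ni: "(\<lambda>r. norm (f r)) integrable_on {0..1}" if "f absolutely_integrable_on {0..1}" for f :: "real \<Rightarrow> complex"
      using that by (simp add: absolutely_integrable_on_def)
    have pos: "?I h1 \<ge> 0" "?I h2 \<ge> 0" by (intro Henstock_Kurzweil_Integration.integral_nonneg ni h; simp)+
    have "?I (forcing h1 h2) \<le> integral {0..1} (\<lambda>r. L * (K * ?I h1) + norm (h2 r))"
    proof (rule integral_le)
      show "(\<lambda>r. norm (forcing h1 h2 r)) integrable_on {0..1}" by (intro ni forcing_integrable h)
      show "(\<lambda>r. L * (K * ?I h1) + norm (h2 r)) integrable_on {0..1}"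
        by (intro Henstock_Kurzweil_Integration.integrable_add ni h integrable_const_ivl)
      fix r :: real assume r: "r \<in> {0..1}"
      have "norm (forcing h1 h2 r) \<le> norm (2 * t * k\<^sup>2 * duhamel h1 r) + norm (h2 r)"
        unfolding forcing_def by (rule norm_triangle_ineq)
      also have "norm (2 * t * k\<^sup>2 * duhamel h1 r) \<le> L * (K * ?I h1)"
        unfolding norm_mult[of "2 * t * k\<^sup>2"] L_def by (intro mult_left_mono K h r) auto
      finally show "norm (forcing h1 h2 r) \<le> L * (K * ?I h1) + norm (h2 r)" by simp
    qed
    also have "\<dots> = L * K * ?I h1 + ?I h2"
      by (subst Henstock_Kurzweil_Integration.integral_add) (auto intro!: ni h)
    also have "\<dots> \<le> (L * K + 1) * (?I h1 + ?I h2)"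
      using K(1) pos by (simp add: algebra_simps L_def)
    finally show "?I (forcing h1 h2) \<le> (L * K + 1) * (?I h1 + ?I h2)" .
  qed
qed

end

section \<open>The resolvent\<close>

lemma linear_vector2:
  fixes f g :: "'a::euclidean_space \<Rightarrow> complex"
  assumes "linear f" "linear g"
  shows "bounded_linear (\<lambda>v. vector [f v, g v] :: complex^2)"
  unfolding linear_conv_bounded_linear[symmetric]
  by (rule linearI) (auto simp: vec_eq_iff forall_2 linear_add[OF assms(1)] linear_add[OF assms(2)]
      linear_cmul[OF assms(1)] linear_cmul[OF assms(2)])

lemma primitive01_vector2:
  fixes F G :: "real \<Rightarrow> complex"
  assumes "primitive01 F f" "primitive01 G g"
  shows "primitive01 (\<lambda>x. vector [F x, G x] :: complex^2) (\<lambda>x. vector [f x, g x])"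
proof -
  have 1: "bounded_linear (\<lambda>c::complex. vector [c, 0] :: complex^2)"
    and 2: "bounded_linear (\<lambda>c::complex. vector [0, c] :: complex^2)"
    by (intro linear_vector2 linear_zero linear_ident)+
  show ?thesis
    by (rule primitive01_cong[OF primitive01_add[OF primitive01_linear[OF assms(1) 1] primitive01_linear[OF assms(2) 2]]])
       (auto simp: vec_eq_iff forall_2)
qed

lemma primitive01_nth: "primitive01 F f \<Longrightarrow> primitive01 (\<lambda>x. F x $ i :: complex) (\<lambda>x. f x $ i)"
  by (rule primitive01_linear[OF _ bounded_linear_vec_nth])

lemma continuous_AE_zero_imp_zero:
  fixes u :: "real \<Rightarrow> 'a::euclidean_space"
  assumes "continuous_on {0..1} u" "negligible N" "\<And>x. x \<in> {0..1} - N \<Longrightarrow> u x = 0" "x \<in> {0..1}"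
  shows "u x = 0"
proof -
  have "((\<lambda>x. norm (u x)) has_integral 0) {0..1}"
    by (rule has_integral_spike[OF assms(2) _ has_integral_0]) (use assms(3) in auto)
  then have "norm (u x) = 0"
    by (intro has_integral_0_cbox_imp_0[of 0 1 "\<lambda>x. norm (u x)"])
       (use assms in \<open>auto intro: continuous_on_norm\<close>)
  then show ?thesis by simp
qed

lemma eq_ae_sym: "eq_ae f g \<Longrightarrow> eq_ae g f"
  by (auto simp: eq_ae_def elim: eventually_mono)

lemma eq_ae_trans: "eq_ae f g \<Longrightarrow> eq_ae g h \<Longrightarrow> eq_ae f h"
  unfolding eq_ae_def by (erule (1) eventually_elim2[where F="ae_filter M01"]) simp

text \<open>Because of the choice in \<open>generalized_deriv2\<close>, even the derivative of the
  zero function is known only almost everywhere. The zero function is what eigenfunctions are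
  compared with to refute injectivity.\<close>

lemma zero_in_Dom_D: "(\<lambda>x. 0) \<in> Dom_D" "eq_ae (generalized_deriv2 (\<lambda>x. 0)) (\<lambda>x. 0)"
proof -
  have "primitive01 (\<lambda>x. 0 :: complex^2) (\<lambda>x. 0)" by (rule primitive01_C1) auto
  from Dom_D_I[OF this this continuous_imp_L2] show "(\<lambda>x. 0) \<in> Dom_D" "eq_ae (generalized_deriv2 (\<lambda>x. 0)) (\<lambda>x. 0)"
    by auto
qed

text \<open>An eigenfunction and the zero function have almost everywhere the same image, against
  injectivity; being continuous, the eigenfunction cannot vanish almost everywhere and yet be
  nonzero at \<open>x\<close>.\<close>

lemma eigenvalue_in_Spec:
  assumes u: "primitive01 u u'" and u': "primitive01 u' g" and g: "g \<in> L2"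
    and bc: "u 0 $ 1 = 0" "u 1 $ 1 = 0" "u' 0 $ 2 = 0" "u' 1 $ 2 = 0"
    and eq: "\<And>x. x \<in> {0..1} \<Longrightarrow> A *v (- g x) = z *s u x"
    and x: "x \<in> {0..1}" "u x \<noteq> 0"
  shows "z \<in> Spec Dom_D (op_AD A)"
  unfolding Spec_def Compl_iff
proof
  assume "z \<in> resolvent_set Dom_D (op_AD A)"
  then have inj: "\<forall>f\<in>Dom_D. \<forall>h\<in>Dom_D. eq_ae (\<lambda>x. op_AD A f x - z *s f x) (\<lambda>x. op_AD A h x - z *s h x) \<longrightarrow> eq_ae f h"
    by (simp add: resolvent_set_def Let_def)
  note D = Dom_D_I[OF u u' g bc]
  obtain N1 where N1: "negligible N1" "\<forall>x\<in>{0..1} - N1. generalized_deriv2 u x = g x"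
    using D(2) unfolding eq_ae_iff_negligible by auto
  obtain N2 where N2: "negligible N2" "\<forall>x\<in>{0..1} - N2. generalized_deriv2 (\<lambda>x. 0) x = 0"
    using zero_in_Dom_D(2) unfolding eq_ae_iff_negligible by auto
  have "eq_ae (\<lambda>x. op_AD A u x - z *s u x) (\<lambda>x. op_AD A (\<lambda>x. 0) x - z *s 0)"
    unfolding eq_ae_iff_negligible op_AD_def op_D_def
    by (rule exI[of _ "N1 \<union> N2"]) (use N1 N2 eq in auto)
  then have "eq_ae u (\<lambda>x. 0)" using inj D(1) zero_in_Dom_D(1) by blast
  then obtain N where N: "negligible N" "\<forall>x\<in>{0..1} - N. u x = 0"
    unfolding eq_ae_iff_negligible by auto
  have "u x = 0"
    by (rule continuous_AE_zero_imp_zero[OF primitive01_continuous[OF u] N(1) _ x(1)]) (use N(2) in auto)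
  then show False using x(2) by simp
qed

text \<open>The second component carries Neumann conditions, so the constant (0, 1) is in the domain
  and D annihilates it, for every matrix \<open>A\<close>.\<close>

lemma zero_in_Spec: "0 \<in> Spec Dom_D (op_AD A)"
proof (rule eigenvalue_in_Spec[where u = "\<lambda>x. vector [0, 1]" and u' = "\<lambda>x. 0" and g = "\<lambda>x. 0" and x = 0])
  show "primitive01 (\<lambda>x. vector [0, 1] :: complex^2) (\<lambda>x. 0)" "primitive01 (\<lambda>x. 0 :: complex^2) (\<lambda>x. 0)"
    by (auto intro: primitive01_C1)
  show "(\<lambda>x. 0) \<in> L2" by (rule continuous_imp_L2) simp
qed (auto simp: vec_eq_iff forall_2)

section \<open>Reduction of the matrix operator to the triangular system\<close>

locale A4_pencil =
  fixes m \<sigma> :: real and k z :: complex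
  assumes m_nonzero: "m \<noteq> 0" and sigma_square: "\<sigma> * \<sigma> = 1" and k_nonzero: "k \<noteq> 0"
    and z_def: "z = of_real m * k\<^sup>2"
begin

sublocale oscillator k "1 / (2 * of_real m)" "of_real \<sigma>"
  by unfold_locales (use k_nonzero sigma_square in \<open>auto simp flip: of_real_mult\<close>)

abbreviation "\<M> \<equiv> A4 (m + \<sigma>) (m - \<sigma>)"

text \<open>The right-hand side in the coordinates p and q. In \<open>source_q\<close> the term
  \<open>source_p\<close> appears because p'' in the first row is eliminated by means of the
  equation for p.\<close>

definition source_p :: "complex^2 \<Rightarrow> complex" where
  "source_p r = - (of_real \<sigma> * r $ 1 - r $ 2) / of_real m"
definition source_q :: "complex^2 \<Rightarrow> complex" where
  "source_q r = - (source_p r + r $ 1) / of_real m"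

definition coord_p :: "complex^2 \<Rightarrow> complex" where "coord_p v = of_real \<sigma> * v $ 1 - v $ 2"

lemma linear_sources: "linear source_p" "linear source_q" "linear coord_p"
proof -
  show l1: "linear source_p"
    by (rule linearI) (auto simp: source_p_def scaleR_conv_of_real[where 'a=complex] field_simps m_nonzero)
  show "linear source_q"
    by (rule linearI) (auto simp: source_q_def linear_add[OF l1] linear_cmul[OF l1] scaleR_conv_of_real[where 'a=complex] field_simps m_nonzero)
  show "linear coord_p"
    by (rule linearI) (auto simp: coord_p_def scaleR_conv_of_real[where 'a=complex] field_simps)
qed

text \<open>The row (\<sigma>, -1) annihilates the nilpotent part, so this combination of the two
  rows involves p alone. The first row, with its p'' replaced from there, is the second equation. No
  information is lost, since \<sigma>^2 = 1 and m \<noteq> 0.\<close>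

lemma pencil_iff:
  "\<M> *v (- g) - z *s v = r \<longleftrightarrow>
     coord_p g = - k\<^sup>2 * coord_p v + source_p r \<and>
     g $ 1 = - k\<^sup>2 * v $ 1 + 2 * (1 / (2 * of_real m)) * k\<^sup>2 * coord_p v + source_q r"
proof -
  define M S where "M = (of_real m :: complex)" and "S = (of_real \<sigma> :: complex)"
  have M: "M \<noteq> 0" and S: "S * S = 1" using m_nonzero s_square by (auto simp: M_def S_def)
  obtain g1 g2 v1 v2 r1 r2 where c: "g $ 1 = g1" "g $ 2 = g2" "v $ 1 = v1" "v $ 2 = v2" "r $ 1 = r1" "r $ 2 = r2"
    by blast
  have "\<M> *v (- g) - z *s v = r \<longleftrightarrow> - ((M + S) * g1 - g2) - M * k\<^sup>2 * v1 = r1 \<and> - (g1 + (M - S) * g2) - M * k\<^sup>2 * v2 = r2"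
    by (auto simp: vec_eq_iff forall_2 A4_def matrix_vector_mult_def sum_2 z_def c M_def S_def algebra_simps)
  also have "\<dots> \<longleftrightarrow> M * (S * g1 - g2) = M * (- k\<^sup>2 * (S * v1 - v2)) - (S * r1 - r2) \<and>
      M * g1 = - (M * k\<^sup>2 * v1) - (S * g1 - g2) - r1"
  proof (intro iffI conjI; elim conjE)
    assume "- ((M + S) * g1 - g2) - M * k\<^sup>2 * v1 = r1" "- (g1 + (M - S) * g2) - M * k\<^sup>2 * v2 = r2"
    then have E: "r1 = - ((M + S) * g1 - g2) - M * k\<^sup>2 * v1" "r2 = - (g1 + (M - S) * g2) - M * k\<^sup>2 * v2"
      by auto
    have "S * (S * g1) = g1" using S by (simp flip: mult.assoc)
    then show "M * (S * g1 - g2) = M * (- k\<^sup>2 * (S * v1 - v2)) - (S * r1 - r2)"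
      unfolding E by (simp add: algebra_simps)
    show "M * g1 = - (M * k\<^sup>2 * v1) - (S * g1 - g2) - r1"
      unfolding E by (simp add: algebra_simps)
  next
    assume E: "M * (S * g1 - g2) = M * (- k\<^sup>2 * (S * v1 - v2)) - (S * r1 - r2)"
      "M * g1 = - (M * k\<^sup>2 * v1) - (S * g1 - g2) - r1"
    show r1: "- ((M + S) * g1 - g2) - M * k\<^sup>2 * v1 = r1"
      using E(2) by algebra
    have "S * (S * g1) = g1" using S by (simp flip: mult.assoc)
    then have "M * (S * g1 - g2) - M * (- k\<^sup>2 * (S * v1 - v2)) + S * (- ((M + S) * g1 - g2) - M * k\<^sup>2 * v1)
       = - (g1 + (M - S) * g2) - M * k\<^sup>2 * v2" by (simp add: algebra_simps)
    then show "- (g1 + (M - S) * g2) - M * k\<^sup>2 * v2 = r2"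
      unfolding r1 E(1) by simp
  qed
  also have "\<dots> \<longleftrightarrow> S * g1 - g2 = - k\<^sup>2 * (S * v1 - v2) - (S * r1 - r2) / M \<and>
      g1 = - k\<^sup>2 * v1 + (- (S * g1 - g2) - r1) / M"
    using M by (auto simp: field_simps)
  also have "\<dots> \<longleftrightarrow> coord_p g = - k\<^sup>2 * coord_p v + source_p r \<and>
     g $ 1 = - k\<^sup>2 * v $ 1 + 2 * (1 / (2 * of_real m)) * k\<^sup>2 * coord_p v + source_q r"
  proof (rule conj_cong)
    have X: "- k\<^sup>2 * (S * v1 - v2) - (S * r1 - r2) / M = - k\<^sup>2 * coord_p v + source_p r"
      by (simp add: coord_p_def source_p_def c M_def S_def minus_divide_left)
    have P: "coord_p g = S * g1 - g2" by (simp add: coord_p_def c S_def)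
    show "S * g1 - g2 = - k\<^sup>2 * (S * v1 - v2) - (S * r1 - r2) / M \<longleftrightarrow> coord_p g = - k\<^sup>2 * coord_p v + source_p r"
      unfolding X P ..
    assume "coord_p g = - k\<^sup>2 * coord_p v + source_p r"
    then have "- k\<^sup>2 * v1 + (- (S * g1 - g2) - r1) / M
       = - k\<^sup>2 * v1 + (k\<^sup>2 * coord_p v - source_p r - r1) / M"
      unfolding P by simp
    also have "\<dots> = - k\<^sup>2 * v $ 1 + 2 * (1 / (2 * of_real m)) * k\<^sup>2 * coord_p v + source_q r"
      using M by (simp add: source_q_def c M_def diff_divide_distrib add_divide_distrib)
    finally show "g1 = - k\<^sup>2 * v1 + (- (S * g1 - g2) - r1) / M \<longleftrightarrow>
       g $ 1 = - k\<^sup>2 * v $ 1 + 2 * (1 / (2 * of_real m)) * k\<^sup>2 * coord_p v + source_q r"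
      by (simp only: c)
  qed
  finally show ?thesis .
qed

abbreviation "h1 r \<equiv> \<lambda>x::real. source_p (r x)"
abbreviation "h2 r \<equiv> \<lambda>x::real. source_q (r x)"

lemma h_integrable:
  assumes "r \<in> L2"
  shows "h1 r absolutely_integrable_on {0..1}" "h2 r absolutely_integrable_on {0..1}"
  using absolutely_integrable_linear[OF L2_integrable[OF assms]] linear_sources
  by (auto simp: linear_conv_bounded_linear o_def)

definition sol_vec where
  "sol_vec p0 p1 r x = (vector [sol_q p0 p1 (h1 r) (h2 r) x,
     of_real \<sigma> * sol_q p0 p1 (h1 r) (h2 r) x - sol_p p0 p1 (h1 r) x] :: complex^2)"
definition sol_vec' where
  "sol_vec' p0 p1 r x = (vector [sol_q' p0 p1 (h1 r) (h2 r) x,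
     of_real \<sigma> * sol_q' p0 p1 (h1 r) (h2 r) x - sol_p' p0 p1 (h1 r) x] :: complex^2)"

text \<open>The second derivative that the resolvent equation prescribes where the solution has the
  value \<open>v\<close> and the right-hand side the value \<open>r\<close>. It is linear in both,
  hence square integrable along with them.\<close>

definition sol_vec2 where
  "sol_vec2 v r = (let q2 = - k\<^sup>2 * v $ 1 + 2 * (1 / (2 * of_real m)) * k\<^sup>2 * coord_p v + source_q r in
     vector [q2, of_real \<sigma> * q2 - (- k\<^sup>2 * coord_p v + source_p r)] :: complex^2)"

lemma sol_vec2: "\<M> *v (- sol_vec2 v r) - z *s v = r"
  unfolding pencil_iff by (simp add: sol_vec2_def Let_def coord_p_def)

lemma sol_vec_coords:
  "sol_vec p0 p1 r x $ 1 = sol_q p0 p1 (h1 r) (h2 r) x"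
  "coord_p (sol_vec p0 p1 r x) = sol_p p0 p1 (h1 r) x"
  by (auto simp: sol_vec_def coord_p_def)

lemma primitive01_sol_vec:
  assumes "r \<in> L2"
  shows "primitive01 (sol_vec p0 p1 r) (sol_vec' p0 p1 r)"
    "primitive01 (sol_vec' p0 p1 r) (\<lambda>x. sol_vec2 (sol_vec p0 p1 r x) (r x))"
proof -
  note P = primitive01_sol_p[OF h_integrable(1)[OF assms], of p0 p1]
  note Q = primitive01_sol_q[OF h_integrable[OF assms], of p0 p1]
  show "primitive01 (sol_vec p0 p1 r) (sol_vec' p0 p1 r)"
    by (rule primitive01_cong[OF primitive01_vector2[OF Q(1)
        primitive01_add[OF primitive01_cmult[OF Q(1), of "of_real \<sigma>"] primitive01_cmult[OF P(1), of "-1"]]]])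
       (auto simp: sol_vec_def sol_vec'_def)
  show "primitive01 (sol_vec' p0 p1 r) (\<lambda>x. sol_vec2 (sol_vec p0 p1 r x) (r x))"
    by (rule primitive01_cong[OF primitive01_vector2[OF Q(2)
        primitive01_add[OF primitive01_cmult[OF Q(2), of "of_real \<sigma>"] primitive01_cmult[OF P(2), of "-1"]]]])
       (auto simp: sol_vec2_def sol_vec'_def Let_def sol_vec_coords vec_eq_iff forall_2)
qed

lemma sol_vec2_L2:
  assumes "v \<in> L2" "r \<in> L2" shows "(\<lambda>x. sol_vec2 (v x) (r x)) \<in> L2"
proof -
  have l: "linear (\<lambda>v. sol_vec2 v 0)" "linear (\<lambda>r. sol_vec2 0 r)"
    using linear_0[OF linear_sources(1)] linear_0[OF linear_sources(2)] linear_0[OF linear_sources(3)]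
    by (auto intro!: linearI simp: sol_vec2_def Let_def vec_eq_iff forall_2 linear_add[OF linear_sources(1)]
       linear_add[OF linear_sources(2)] linear_add[OF linear_sources(3)] linear_cmul[OF linear_sources(1)]
       linear_cmul[OF linear_sources(2)] linear_cmul[OF linear_sources(3)] scaleR_conv_of_real[where 'a=complex] add_divide_distrib algebra_simps)
  have "(\<lambda>x. sol_vec2 (v x) 0 + sol_vec2 0 (r x)) \<in> L2"
    by (intro L2_add L2_linear[OF assms(1)] L2_linear[OF assms(2)]) (use l in \<open>auto simp: linear_conv_bounded_linear\<close>)
  moreover have "sol_vec2 v 0 + sol_vec2 0 r = sol_vec2 v r" for v r
    using linear_0[OF linear_sources(1)] linear_0[OF linear_sources(2)] linear_0[OF linear_sources(3)]
    by (auto simp: sol_vec2_def Let_def vec_eq_iff forall_2 algebra_simps)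
  ultimately show ?thesis by simp
qed

lemma sol_vec_boundary:
  assumes "sol_q p0 p1 (h1 r) (h2 r) 1 = 0" "of_real \<sigma> * sol_q' p0 p1 (h1 r) (h2 r) 1 = sol_p' p0 p1 (h1 r) 1"
  shows "sol_vec p0 p1 r 0 $ 1 = 0" "sol_vec p0 p1 r 1 $ 1 = 0" "sol_vec' p0 p1 r 0 $ 2 = 0" "sol_vec' p0 p1 r 1 $ 2 = 0"
proof -
  show "sol_vec' p0 p1 r 0 $ 2 = 0" using s_square by (simp add: sol_vec'_def mult.left_commute)
qed (use assms in \<open>auto simp: sol_vec_def sol_vec'_def\<close>)

text \<open>A kernel vector of the boundary matrix supplies initial data of an eigenfunction. It is
  not identically zero, because \<open>p0\<close> and \<open>p1\<close> are the value and the slope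
  of its p-coordinate at 0.\<close>

lemma char_det_zero_in_Spec:
  assumes "char_det = 0" shows "z \<in> Spec Dom_D (op_AD \<M>)"
proof -
  obtain p0 p1 where p: "(p0, p1) \<noteq> (0, 0)" "m11 * p0 + m12 * p1 = 0" "m21 * p0 + m22 * p1 = 0"
    using singular_kernel[OF assms] by blast
  let ?r = "\<lambda>x::real. 0 :: complex^2"
  have r: "?r \<in> L2" by (rule continuous_imp_L2) simp
  have h0: "h1 ?r = (\<lambda>x. 0)" "h2 ?r = (\<lambda>x. 0)" using linear_sources linear_0 by auto
  have d0: "duhamel (\<lambda>x. 0) = (\<lambda>x. 0)" "duhamel' (\<lambda>x. 0) = (\<lambda>x. 0)"
    by (auto simp: duhamel_def[abs_def] duhamel'_def[abs_def])
  have fo: "forcing (\<lambda>x. 0) (\<lambda>x. 0) = (\<lambda>x. 0)" by (simp add: forcing_def[abs_def] d0)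
  have bc: "sol_q p0 p1 (h1 ?r) (h2 ?r) 1 = 0"
    "of_real \<sigma> * sol_q' p0 p1 (h1 ?r) (h2 ?r) 1 = sol_p' p0 p1 (h1 ?r) 1"
    using boundary_1[of p0 p1 "h1 ?r" "h2 ?r"] p(2,3) by (auto simp: h0 d0 fo)
  have "\<exists>x\<in>{0..1}. sol_vec p0 p1 ?r x \<noteq> 0"
  proof (rule ccontr)
    assume "\<not> (\<exists>x\<in>{0..1}. sol_vec p0 p1 ?r x \<noteq> 0)"
    then have "coord_p (sol_vec p0 p1 ?r x) = 0" if "x \<in> {0..1}" for x
      using that linear_0[OF linear_sources(3)] by auto
    then have sp: "p0 * cs x + p1 * sn x = 0" if "x \<in> {0..1}" for x
      using that by (simp add: sol_vec_coords sol_p_def h0 d0)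
    from sp[of 0] have p0: "p0 = 0" by simp
    have "((\<lambda>x. p1 * sn x) has_vector_derivative p1 * cs 0) (at 0 within {0..1})"
      by (intro has_vector_derivative_mult_right sn_derivative)
    moreover have "((\<lambda>x. p1 * sn x) has_vector_derivative 0) (at 0 within {0..1})"
      by (rule has_vector_derivative_transform[OF _ _ has_vector_derivative_const[of 0]]) (use sp p0 in auto)
    ultimately have "p1 * cs 0 = 0"
      using vector_derivative_unique_within_closed_interval[of 0 1 0] by auto
    then show False using p(1) p0 by simp
  qed
  then obtain x where x: "x \<in> {0..1}" "sol_vec p0 p1 ?r x \<noteq> 0" by blast
  show ?thesis
  proof (rule eigenvalue_in_Spec[OF primitive01_sol_vec[OF r] _ sol_vec_boundary[OF bc] _ x])
    show "(\<lambda>x. sol_vec2 (sol_vec p0 p1 ?r x) 0) \<in> L2"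
      by (rule sol_vec2_L2[OF continuous_imp_L2[OF primitive01_continuous[OF primitive01_sol_vec(1)[OF r]]] r])
    show "\<M> *v - sol_vec2 (sol_vec p0 p1 ?r x) 0 = z *s sol_vec p0 p1 ?r x" for x
      using sol_vec2[of "sol_vec p0 p1 ?r x" 0] by simp
  qed
qed

section \<open>The explicit resolvent and its bound\<close>

definition solution :: "(real \<Rightarrow> complex^2) \<Rightarrow> real \<Rightarrow> complex^2" where
  "solution r = sol_vec (init0 (h1 r) (h2 r)) (init1 (h1 r) (h2 r)) r"

lemma solution_in_Dom_D:
  assumes "char_det \<noteq> 0" "r \<in> L2"
  shows "solution r \<in> Dom_D" "eq_ae (\<lambda>x. op_AD \<M> (solution r) x - z *s solution r x) r"
proof -
  note bc = boundary_1_iff[OF assms(1), THEN iffD2, OF conjI[OF refl refl], of "h1 r" "h2 r"]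
  note P = primitive01_sol_vec[OF assms(2), of "init0 (h1 r) (h2 r)" "init1 (h1 r) (h2 r)"]
  have L: "(\<lambda>x. sol_vec2 (solution r x) (r x)) \<in> L2"
    unfolding solution_def
    by (rule sol_vec2_L2[OF continuous_imp_L2[OF primitive01_continuous[OF P(1)]] assms(2)])
  note D = Dom_D_I[OF P L[unfolded solution_def] sol_vec_boundary[OF conjunct1[OF bc] conjunct2[OF bc]],
      folded solution_def]
  show "solution r \<in> Dom_D" by (rule D(1))
  obtain N where N: "negligible N"
    "\<forall>x\<in>{0..1} - N. generalized_deriv2 (solution r) x = sol_vec2 (solution r x) (r x)"
    using D(2) unfolding eq_ae_iff_negligible by auto
  show "eq_ae (\<lambda>x. op_AD \<M> (solution r) x - z *s solution r x) r"
    unfolding eq_ae_iff_negligible op_AD_def op_D_def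
    by (rule exI[of _ N]) (use N sol_vec2 in auto)
qed

lemma Dom_D_solution:
  assumes cd: "char_det \<noteq> 0" and r: "r \<in> L2" and f: "f \<in> Dom_D"
    and eq: "eq_ae (\<lambda>x. op_AD \<M> f x - z *s f x) r"
  shows "eq_ae f (solution r)"
proof -
  obtain u u' where u: "eq_ae f u" "primitive01 u u'" "primitive01 u' (generalized_deriv2 f)"
    "u 0 $ 1 = 0" "u 1 $ 1 = 0" "u' 0 $ 2 = 0" "u' 1 $ 2 = 0"
    using Dom_D_E[OF f] by metis
  obtain N1 where N1: "negligible N1" "\<And>x. x \<in> {0..1} - N1 \<Longrightarrow> f x = u x"
    using u(1) unfolding eq_ae_iff_negligible by auto
  obtain N2 where N2: "negligible N2" "\<And>x. x \<in> {0..1} - N2 \<Longrightarrow> \<M> *v (- generalized_deriv2 f x) - z *s f x = r x"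
    using eq unfolding eq_ae_iff_negligible op_AD_def op_D_def by auto
  define N where "N = N1 \<union> N2"
  have N: "negligible N" using N1 N2 by (simp add: N_def)
  have g: "\<M> *v (- generalized_deriv2 f x) - z *s u x = r x" if "x \<in> {0..1} - N" for x
    using N1(2)[of x] N2(2)[of x] that by (simp add: N_def)
  have bl: "bounded_linear coord_p" using linear_sources by (simp add: linear_conv_bounded_linear)
  define p where "p x = coord_p (u x)" for x
  define p' where "p' x = coord_p (u' x)" for x
  define q where "q x = u x $ 1" for x
  define q' where "q' x = u' x $ 1" for x
  have p: "primitive01 p p'" unfolding p_def[abs_def] p'_def[abs_def] by (rule primitive01_linear[OF u(2) bl])
  have q: "primitive01 q q'" unfolding q_def[abs_def] q'_def[abs_def] by (rule primitive01_nth[OF u(2)])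
  \<comment> \<open>The resolvent equation holds only off \<open>N\<close>. Exchanging the
    generalized derivative for the right-hand side on \<open>N\<close> still leaves a derivative of
    \<open>p'\<close>, so from here on the system holds at every point and
    \<open>system_unique\<close> applies with reflexivity.\<close>
  have p2: "primitive01 p' (\<lambda>x. - k\<^sup>2 * p x + h1 r x)"
    by (rule primitive01_cong_AE[OF primitive01_linear[OF u(3) bl] N])
       (use g in \<open>simp_all only: pencil_iff p_def p'_def\<close>)
  have q2: "primitive01 q' (\<lambda>x. - k\<^sup>2 * q x + 2 * (1 / (2 * of_real m)) * k\<^sup>2 * p x + h2 r x)"
    by (rule primitive01_cong_AE[OF primitive01_nth[OF u(3), of 1] N])
       (use g in \<open>simp_all only: pencil_iff p_def q_def q'_def\<close>)
  have q0: "q 0 = 0" "q' 0 = of_real \<sigma> * p' 0"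
    using u(4,6) s_square by (auto simp: q_def q'_def p'_def coord_p_def simp flip: mult.assoc)
  note U = system_unique[OF p p2 refl q q2 refl h_integrable[OF r] q0]
  have "sol_q (p 0) (p' 0) (h1 r) (h2 r) 1 = 0 \<and>
     of_real \<sigma> * sol_q' (p 0) (p' 0) (h1 r) (h2 r) 1 = sol_p' (p 0) (p' 0) (h1 r) 1"
    using U(2-4)[of 1, symmetric] u(5,7) by (auto simp: q_def q'_def p'_def coord_p_def)
  then have init: "p 0 = init0 (h1 r) (h2 r)" "p' 0 = init1 (h1 r) (h2 r)"
    using boundary_1_iff[OF cd] by auto
  have "u x = solution r x" if "x \<in> {0..1}" for x
  proof -
    have "p x = sol_p (p 0) (p' 0) (h1 r) x" "q x = sol_q (p 0) (p' 0) (h1 r) (h2 r) x"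
      using U that by blast+
    moreover have "u x = vector [q x, of_real \<sigma> * q x - p x]"
      by (simp add: vec_eq_iff forall_2 q_def p_def coord_p_def)
    ultimately show ?thesis by (simp only: solution_def sol_vec_def init)
  qed
  then show ?thesis
    unfolding eq_ae_iff_negligible using N1 by (intro exI[of _ N1]) auto
qed

text \<open>With the constant hidden, the estimate for the explicit solution is assembled by closure
  rules that follow its formula. Initial data and values at 1 take part as functions constant in
  x.\<close>

definition bounded_by_L2 :: "((real \<Rightarrow> complex^2) \<Rightarrow> real \<Rightarrow> complex) \<Rightarrow> bool" where
  "bounded_by_L2 \<Phi> \<longleftrightarrow> (\<exists>C. \<forall>r\<in>L2. \<forall>x\<in>{0..1}. norm (\<Phi> r x) \<le> C * L2_norm r)"

lemma bounded_by_L2_add: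
  assumes "bounded_by_L2 \<Phi>" "bounded_by_L2 \<Psi>"
  shows "bounded_by_L2 (\<lambda>r x. \<Phi> r x + \<Psi> r x)"
proof -
  obtain C D where CD: "\<forall>r\<in>L2. \<forall>x\<in>{0..1}. norm (\<Phi> r x) \<le> C * L2_norm r"
      "\<forall>r\<in>L2. \<forall>x\<in>{0..1}. norm (\<Psi> r x) \<le> D * L2_norm r"
    using assms by (auto simp: bounded_by_L2_def)
  show ?thesis unfolding bounded_by_L2_def
  proof (intro exI[of _ "C + D"] ballI)
    fix r and x :: real assume "r \<in> L2" "x \<in> {0..1}"
    then have "norm (\<Phi> r x + \<Psi> r x) \<le> C * L2_norm r + D * L2_norm r"
      using CD by (intro norm_triangle_mono) auto
    then show "norm (\<Phi> r x + \<Psi> r x) \<le> (C + D) * L2_norm r" by (simp add: algebra_simps)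
  qed
qed

lemma bounded_by_L2_mult:
  assumes "bounded_by_L2 \<Phi>" "continuous_on {0..1} g"
  shows "bounded_by_L2 (\<lambda>r x. g x * \<Phi> r x)"
proof -
  obtain C where C: "\<forall>r\<in>L2. \<forall>x\<in>{0..1}. norm (\<Phi> r x) \<le> C * L2_norm r"
    using assms by (auto simp: bounded_by_L2_def)
  have "bounded (g ` {0..1})" by (intro compact_imp_bounded compact_continuous_image assms) auto
  then obtain B where B: "\<forall>x\<in>{0..1}. norm (g x) \<le> B" unfolding bounded_iff by blast
  show ?thesis unfolding bounded_by_L2_def
  proof (intro exI[of _ "B * C"] ballI)
    fix r and x :: real assume rx: "r \<in> L2" "x \<in> {0..1}"
    have "norm (g x * \<Phi> r x) \<le> B * (C * L2_norm r)"
      unfolding norm_mult using B C rx order_trans[OF norm_ge_zero B[THEN bspec, OF rx(2)]]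
      by (intro mult_mono) auto
    then show "norm (g x * \<Phi> r x) \<le> B * C * L2_norm r" by (simp add: mult_ac)
  qed
qed

lemma bounded_by_L2_cmult: "bounded_by_L2 \<Phi> \<Longrightarrow> bounded_by_L2 (\<lambda>r x. c * \<Phi> r x)"
  by (rule bounded_by_L2_mult[OF _ continuous_on_const])

lemma bounded_by_L2_divide: "bounded_by_L2 \<Phi> \<Longrightarrow> bounded_by_L2 (\<lambda>r x. \<Phi> r x / c)"
  using bounded_by_L2_cmult[of \<Phi> "inverse c"] by (simp add: divide_inverse mult.commute)

lemma bounded_by_L2_diff:
  assumes "bounded_by_L2 \<Phi>" "bounded_by_L2 \<Psi>"
  shows "bounded_by_L2 (\<lambda>r x. \<Phi> r x - \<Psi> r x)"
  using bounded_by_L2_add[OF assms(1) bounded_by_L2_cmult[OF assms(2), of "-1"]] by simp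

lemma bounded_by_L2_at_1:
  "bounded_by_L2 \<Phi> \<Longrightarrow> bounded_by_L2 (\<lambda>r x. \<Phi> r 1)"
  unfolding bounded_by_L2_def by fastforce

lemma integral_h_bound:
  obtains C where "\<And>r. r \<in> L2 \<Longrightarrow> integral {0..1} (\<lambda>x. norm (h1 r x)) \<le> C * L2_norm r"
    "\<And>r. r \<in> L2 \<Longrightarrow> integral {0..1} (\<lambda>x. norm (h2 r x)) \<le> C * L2_norm r"
proof -
  obtain C1 C2 where C: "\<And>v. norm (source_p v) \<le> norm v * C1" "\<And>v. norm (source_q v) \<le> norm v * C2"
    using linear_sources bounded_linear.bounded by (metis linear_conv_bounded_linear)
  define C where "C = max 0 (max C1 C2)"
  have C': "norm (source_p v) \<le> C * norm v" "norm (source_q v) \<le> C * norm v" for v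
  proof -
    have "C1 \<le> C" "C2 \<le> C" by (auto simp: C_def)
    then show "norm (source_p v) \<le> C * norm v" "norm (source_q v) \<le> C * norm v"
      using order_trans[OF C(1)[of v] mult_left_mono[of C1 C "norm v"]]
        order_trans[OF C(2)[of v] mult_left_mono[of C2 C "norm v"]] by (simp_all add: mult.commute)
  qed
  have C0: "C \<ge> 0" by (simp add: C_def)
  have "integral {0..1} (\<lambda>x. norm (f (r x))) \<le> C * L2_norm r"
    if r: "r \<in> L2" and f: "f = source_p \<or> f = source_q" for f r
  proof -
    have "(\<lambda>x. norm (r x)) absolutely_integrable_on {0..1}"
      using absolutely_integrable_norm[OF L2_integrable[OF r]] by (simp add: o_def)
    then have i: "(\<lambda>x. norm (r x)) integrable_on {0..1}" by (simp add: absolutely_integrable_on_def)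
    have "integral {0..1} (\<lambda>x. norm (f (r x))) \<le> integral {0..1} (\<lambda>x. C * norm (r x))"
      by (rule integral_le)
         (use f C' h_integrable[OF r] integrable_cmul[OF i, of C] in \<open>auto simp: absolutely_integrable_on_def\<close>)
    also have "\<dots> = C * integral {0..1} (\<lambda>x. norm (r x))" by simp
    also have "\<dots> \<le> C * L2_norm r" by (intro mult_left_mono integral_norm_le_L2_norm r C0)
    finally show ?thesis .
  qed
  then show ?thesis using that[of C] by blast
qed

lemma bounded_by_L2_duhamel:
  "bounded_by_L2 (\<lambda>r. duhamel (h1 r))" "bounded_by_L2 (\<lambda>r. duhamel' (h1 r))"
  "bounded_by_L2 (\<lambda>r. duhamel (forcing (h1 r) (h2 r)))" "bounded_by_L2 (\<lambda>r. duhamel' (forcing (h1 r) (h2 r)))"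
proof -
  obtain K where K: "K \<ge> 0"
    "\<And>h x. h absolutely_integrable_on {0..1} \<Longrightarrow> x \<in> {0..1} \<Longrightarrow> norm (duhamel h x) \<le> K * integral {0..1} (\<lambda>r. norm (h r))"
    "\<And>h x. h absolutely_integrable_on {0..1} \<Longrightarrow> x \<in> {0..1} \<Longrightarrow> norm (duhamel' h x) \<le> K * integral {0..1} (\<lambda>r. norm (h r))"
    using duhamel_bound by blast
  obtain C where C: "\<And>r. r \<in> L2 \<Longrightarrow> integral {0..1} (\<lambda>x. norm (h1 r x)) \<le> C * L2_norm r"
    "\<And>r. r \<in> L2 \<Longrightarrow> integral {0..1} (\<lambda>x. norm (h2 r x)) \<le> C * L2_norm r"
    using integral_h_bound by blast
  obtain L where L: "L \<ge> 0"
    "\<And>h1 h2. h1 absolutely_integrable_on {0..1} \<Longrightarrow> h2 absolutely_integrable_on {0..1} \<Longrightarrow>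
       integral {0..1} (\<lambda>x. norm (forcing h1 h2 x)) \<le>
       L * (integral {0..1} (\<lambda>r. norm (h1 r)) + integral {0..1} (\<lambda>r. norm (h2 r)))"
    using norm_integral_forcing by blast
  have F: "integral {0..1} (\<lambda>x. norm (forcing (h1 r) (h2 r) x)) \<le> L * (C * L2_norm r + C * L2_norm r)"
    if "r \<in> L2" for r
    by (rule order_trans[OF L(2)[OF h_integrable[OF that]]]) (intro mult_left_mono add_mono C that L)
  have 1: "K * integral {0..1} (\<lambda>x. norm (h1 r x)) \<le> (K * C) * L2_norm r" if "r \<in> L2" for r
    using mult_left_mono[OF C(1)[OF that] K(1)] by (simp add: mult_ac)
  have 2: "K * integral {0..1} (\<lambda>x. norm (forcing (h1 r) (h2 r) x)) \<le> (K * L * 2 * C) * L2_norm r" if "r \<in> L2" for r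
    using mult_left_mono[OF F[OF that] K(1)] by (simp add: algebra_simps)
  show "bounded_by_L2 (\<lambda>r. duhamel (h1 r))"
    unfolding bounded_by_L2_def
    by (intro exI[of _ "K * C"] ballI, rule order_trans[OF _ 1]) (intro K h_integrable; assumption)+
  show "bounded_by_L2 (\<lambda>r. duhamel' (h1 r))"
    unfolding bounded_by_L2_def
    by (intro exI[of _ "K * C"] ballI, rule order_trans[OF _ 1]) (intro K h_integrable; assumption)+
  show "bounded_by_L2 (\<lambda>r. duhamel (forcing (h1 r) (h2 r)))"
    unfolding bounded_by_L2_def
    by (intro exI[of _ "K * L * 2 * C"] ballI, rule order_trans[OF _ 2]) (intro K forcing_integrable h_integrable; assumption)+
  show "bounded_by_L2 (\<lambda>r. duhamel' (forcing (h1 r) (h2 r)))"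
    unfolding bounded_by_L2_def
    by (intro exI[of _ "K * L * 2 * C"] ballI, rule order_trans[OF _ 2]) (intro K forcing_integrable h_integrable; assumption)+
qed

lemma bounded_by_L2_solution:
  "bounded_by_L2 (\<lambda>r x. solution r x $ 1)" "bounded_by_L2 (\<lambda>r x. solution r x $ 2)"
proof -
  have r1: "bounded_by_L2 (\<lambda>r x. rhs1 (h1 r) (h2 r))"
    unfolding rhs1_def
    using bounded_by_L2_cmult[OF bounded_by_L2_at_1[OF bounded_by_L2_duhamel(3)], of "-1"] by simp
  have r2: "bounded_by_L2 (\<lambda>r x. rhs2 (h1 r) (h2 r))"
    unfolding rhs2_def minus_diff_eq
    by (intro bounded_by_L2_diff bounded_by_L2_cmult bounded_by_L2_at_1 bounded_by_L2_duhamel)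
  have i0: "bounded_by_L2 (\<lambda>r x. init0 (h1 r) (h2 r))"
    unfolding init0_def by (intro bounded_by_L2_divide bounded_by_L2_cmult bounded_by_L2_diff r1 r2)
  have i1: "bounded_by_L2 (\<lambda>r x. init1 (h1 r) (h2 r))"
    unfolding init1_def by (intro bounded_by_L2_divide bounded_by_L2_cmult bounded_by_L2_diff r1 r2)
  have cont: "continuous_on {0..1} res0" "continuous_on {0..1} res1"
    using primitive01_res primitive01_continuous by auto
  have p: "bounded_by_L2 (\<lambda>r x. sol_p (init0 (h1 r) (h2 r)) (init1 (h1 r) (h2 r)) (h1 r) x)"
    unfolding sol_p_def mult.commute[of "init0 _ _"] mult.commute[of "init1 _ _"]
    by (intro bounded_by_L2_add bounded_by_L2_mult i0 i1 bounded_by_L2_duhamel continuous_intros)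
  have q: "bounded_by_L2 (\<lambda>r x. sol_q (init0 (h1 r) (h2 r)) (init1 (h1 r) (h2 r)) (h1 r) (h2 r) x)"
    unfolding sol_q_def mult.commute[of "init0 _ _"] mult.commute[of "init1 _ _"]
    by (intro bounded_by_L2_add bounded_by_L2_mult i0 i1 bounded_by_L2_duhamel continuous_intros cont)
  show "bounded_by_L2 (\<lambda>r x. solution r x $ 1)"
    using q by (simp add: solution_def sol_vec_def)
  show "bounded_by_L2 (\<lambda>r x. solution r x $ 2)"
    using bounded_by_L2_diff[OF bounded_by_L2_cmult[OF q, of "of_real \<sigma>"] p]
    by (simp add: solution_def sol_vec_def)
qed

lemma solution_bound:
  obtains C where "\<And>r. r \<in> L2 \<Longrightarrow> L2_norm (solution r) \<le> C * L2_norm r"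
proof -
  obtain C D where C: "\<forall>r\<in>L2. \<forall>x\<in>{0..1}. norm (solution r x $ 1) \<le> C * L2_norm r"
    and D: "\<forall>r\<in>L2. \<forall>x\<in>{0..1}. norm (solution r x $ 2) \<le> D * L2_norm r"
    using bounded_by_L2_solution unfolding bounded_by_L2_def by blast
  show ?thesis
  proof (rule that[of "C + D"], rule L2_norm_le)
    fix r assume r: "r \<in> L2"
    show "continuous_on {0..1} (solution r)"
      unfolding solution_def by (rule primitive01_continuous[OF primitive01_sol_vec(1)[OF r]])
    fix x :: real assume x: "x \<in> {0..1}"
    have "norm (solution r x) \<le> norm (solution r x $ 1) + norm (solution r x $ 2)"
      using L2_set_le_sum[of UNIV "\<lambda>i. norm (solution r x $ i)"] by (simp add: norm_vec_def sum_2)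
    also have "\<dots> \<le> C * L2_norm r + D * L2_norm r" using C D r x by (intro add_mono) auto
    finally show "norm (solution r x) \<le> (C + D) * L2_norm r" by (simp add: algebra_simps)
  qed
qed

text \<open>\<open>Dom_D_solution\<close> identifies every \<open>f\<close> of the domain with
  \<open>solution (R f)\<close> almost everywhere. That gives injectivity at once, and the norm
  bound because the norm ignores null sets; surjectivity is
  \<open>solution_in_Dom_D\<close>.\<close>

lemma char_det_nonzero_resolvent:
  assumes cd: "char_det \<noteq> 0" shows "z \<notin> Spec Dom_D (op_AD \<M>)"
proof -
  define R where "R f = (\<lambda>x. op_AD \<M> f x - z *s f x)" for f
  have RL2: "R f \<in> L2" and fL2: "f \<in> L2" if "f \<in> Dom_D" for f
  proof -
    show f: "f \<in> L2" using that by (simp add: Dom_D_def W22_def)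
    have g: "generalized_deriv2 f \<in> L2" using Dom_D_E[OF that] by metis
    have "linear (\<lambda>v. \<M> *v (- v))" "linear (\<lambda>v::complex^2. - (z *s v))"
      by (auto intro!: linearI simp: vec_eq_iff forall_2 matrix_vector_mult_def sum_2 scaleR_conv_of_real[where 'a=complex] algebra_simps)
    then have "(\<lambda>x. \<M> *v (- generalized_deriv2 f x) + - (z *s f x)) \<in> L2"
      by (intro L2_add L2_linear[OF g] L2_linear[OF f]) (auto simp: linear_conv_bounded_linear)
    then show "R f \<in> L2" by (simp add: R_def[abs_def] op_AD_def op_D_def)
  qed
  have sol: "eq_ae f (solution r)" if "f \<in> Dom_D" "r \<in> L2" "eq_ae (R f) r" for f r
    using Dom_D_solution[OF cd that(2,1)] that(3) by (simp add: R_def)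
  obtain C where C: "\<And>r. r \<in> L2 \<Longrightarrow> L2_norm (solution r) \<le> C * L2_norm r"
    using solution_bound by blast
  have "z \<in> resolvent_set Dom_D (op_AD \<M>)"
    unfolding resolvent_set_def Let_def mem_Collect_eq R_def[symmetric]
  proof (intro conjI ballI impI exI[of _ C])
    fix f h assume fh: "f \<in> Dom_D" "h \<in> Dom_D" "eq_ae (R f) (R h)"
    have "eq_ae f (solution (R h))" by (rule sol[OF fh(1) RL2[OF fh(2)] fh(3)])
    moreover have "eq_ae h (solution (R h))"
      by (rule sol[OF fh(2) RL2[OF fh(2)]]) (simp add: eq_ae_def)
    ultimately show "eq_ae f h" using eq_ae_trans eq_ae_sym by blast
  next
    fix r assume r: "r \<in> L2"
    show "\<exists>f\<in>Dom_D. eq_ae (R f) r"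
      using solution_in_Dom_D[OF cd r] by (auto simp: R_def)
  next
    fix f assume f: "f \<in> Dom_D"
    have e: "eq_ae f (solution (R f))"
      by (rule sol[OF f RL2[OF f]]) (simp add: eq_ae_def)
    have "solution (R f) \<in> L2" using fL2[OF solution_in_Dom_D(1)[OF cd RL2[OF f]]] .
    from L2_norm_cong_AE[OF fL2[OF f] this e]
    show "L2_norm f \<le> C * L2_norm (R f)" using C[OF RL2[OF f]] by simp
  qed
  then show ?thesis by (simp add: Spec_def)
qed

lemma Spec_iff: "z \<in> Spec Dom_D (op_AD \<M>) \<longleftrightarrow> (1 + 2 * of_real (m * \<sigma>))\<^sup>2 * (sin k)\<^sup>2 = k\<^sup>2"
proof -
  have nz: "of_real \<sigma> \<noteq> (0::complex)" using sigma_square by auto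
  have "char_det = 0 \<longleftrightarrow> (1 / (2 * of_real m))\<^sup>2 = (1 / (2 * of_real m) + of_real \<sigma>)\<^sup>2 * (sn 1)\<^sup>2"
    using nz k_nonzero by (simp add: char_det_def)
  also have "1 / (2 * of_real m) + of_real \<sigma> = (1 + 2 * of_real (m * \<sigma>)) / (2 * of_real m :: complex)"
    using m_nonzero by (simp add: field_simps)
  also have "(1 / (2 * of_real m))\<^sup>2 = ((1 + 2 * of_real (m * \<sigma>)) / (2 * of_real m :: complex))\<^sup>2 * (sn 1)\<^sup>2 \<longleftrightarrow>
      (1 + 2 * of_real (m * \<sigma>))\<^sup>2 * (sin k)\<^sup>2 = k\<^sup>2"
    using m_nonzero k_nonzero by (auto simp: sn_def power_divide field_simps)
  finally show ?thesis using char_det_zero_in_Spec char_det_nonzero_resolvent by blast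
qed

end

section \<open>The characteristic equation\<close>

text \<open>On the imaginary axis the sine grows exponentially: used once to find an essential
  singularity and once to bound imaginary solutions.\<close>

lemma sin_imaginary: "sin (\<i> * of_real y) = \<i> * of_real (sinh y)"
  by (simp add: sin_i_times sinh_field_def exp_minus exp_of_real)

lemma infinite_sin_eq_linear:
  fixes b :: complex
  assumes "b \<noteq> 0"
  shows "infinite {k. k \<noteq> 0 \<and> b\<^sup>2 * (sin k)\<^sup>2 = k\<^sup>2}"
proof -
  define F where "F w = w * sin (1 / w)" for w :: complex
  have hol: "F holomorphic_on (UNIV - {0})"
    unfolding F_def[abs_def] by (intro holomorphic_intros) auto
  define r where "r n = 1 / (2 * pi * real n + pi / 2)" for n :: nat
  have blowup: False if lim: "(G \<longlongrightarrow> l) (at 0)" and w: "filterlim w (at 0) sequentially"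
    and big: "filterlim (\<lambda>n. norm (G (w n))) at_top sequentially"
    for G :: "complex \<Rightarrow> complex" and l w
  proof -
    have "((\<lambda>n. norm (G (w n))) \<longlongrightarrow> norm l) sequentially"
      by (intro tendsto_norm filterlim_compose[OF lim w])
    then show False
      using big not_tendsto_and_filterlim_at_infinity[of sequentially "\<lambda>n. norm (G (w n))" "norm l"]
      by (simp add: filterlim_at_top_imp_at_infinity)
  qed
  have 1: "\<not> (F \<longlongrightarrow> l) (at 0)" for l
  proof
    assume lim: "(F \<longlongrightarrow> l) (at 0)"
    \<comment> \<open>Here |F| is sinh(n + 1)/(n + 1), which is unbounded, so \<open>F\<close> has
      no finite limit at 0; \<open>Suc\<close> keeps the sequence away from division by
      zero.\<close>
    define w where "w n = 1 / (\<i> * of_nat (Suc n))" for n :: nat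
    show False
    proof (rule blowup[OF lim, of w])
      have "w \<longlonglongrightarrow> 0"
      proof (rule tendsto_norm_zero_cancel)
        have "(\<lambda>n. norm (w n)) = (\<lambda>n. 1 / real (Suc n))"
          by (auto simp: w_def norm_divide norm_mult simp del: of_nat_Suc)
        then show "(\<lambda>n. norm (w n)) \<longlonglongrightarrow> 0" by (simp only: LIMSEQ_Suc[OF lim_1_over_n])
      qed
      moreover have "w n \<noteq> 0" for n by (simp add: w_def del: of_nat_Suc)
      ultimately show "filterlim w (at 0) sequentially" by (simp add: filterlim_at)
      have "norm (F (w n)) = sinh (real (Suc n)) / real (Suc n)" for n
      proof -
        have "1 / w n = \<i> * complex_of_real (real (Suc n))"
          unfolding w_def by (simp add: field_simps del: of_nat_Suc)
        then have "sin (1 / w n) = \<i> * complex_of_real (sinh (real (Suc n)))"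
          by (simp only: sin_imaginary)
        then have "norm (sin (1 / w n)) = sinh (real (Suc n))"
          by (simp only: norm_mult norm_ii norm_of_real) simp
        moreover have "norm (w n) = 1 / real (Suc n)"
          by (simp add: w_def norm_divide norm_mult del: of_nat_Suc)
        ultimately show ?thesis
          unfolding F_def by (simp add: norm_mult del: of_nat_Suc)
      qed
      moreover have "filterlim (\<lambda>n. sinh (real (Suc n)) / real (Suc n)) at_top sequentially"
        unfolding sinh_field_def by real_asymp
      ultimately show "filterlim (\<lambda>n. norm (F (w n))) at_top sequentially" by simp
    qed
  qed
  have 2: "\<not> ((inverse \<circ> F) \<longlongrightarrow> l) (at 0)" for l
  proof
    assume lim: "((inverse \<circ> F) \<longlongrightarrow> l) (at 0)"
    \<comment> \<open>At these points the sine is 1, hence F(w) = w tends to 0 and 1/F blows up: the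
      singularity is not a pole either.\<close>
    define w where "w n = complex_of_real (r n)" for n
    have rpos: "r n > 0" for n by (simp add: r_def add_nonneg_pos)
    show False
    proof (rule blowup[OF lim, of w])
      have "r \<longlonglongrightarrow> 0" unfolding r_def[abs_def] by real_asymp
      then have "w \<longlonglongrightarrow> 0" unfolding w_def[abs_def] using tendsto_of_real[of r 0 sequentially] by simp
      then show "filterlim w (at 0) sequentially"
        using rpos by (auto simp: filterlim_at w_def less_le)
      have "norm ((inverse \<circ> F) (w n)) = 2 * pi * real n + pi / 2" for n
      proof -
        have "1 / w n = complex_of_real (2 * pi * real n + pi / 2)"
          using rpos[of n] by (simp add: w_def r_def)
        moreover have "sin (2 * pi * real n + pi / 2) = 1"
          using cos_2npi[of n] by (simp add: sin_add mult_ac)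
        ultimately have "sin (1 / w n) = 1" by (metis of_real_1 sin_of_real)
        then have "norm ((inverse \<circ> F) (w n)) = inverse (norm (w n))"
          by (simp add: F_def norm_inverse)
        also have "\<dots> = inverse (r n)" using rpos[of n] by (simp add: w_def)
        finally show ?thesis by (simp add: r_def)
      qed
      moreover have "filterlim (\<lambda>n::nat. 2 * pi * real n + pi / 2) at_top sequentially"
        by real_asymp
      ultimately show "filterlim (\<lambda>n. norm ((inverse \<circ> F) (w n))) at_top sequentially" by simp
    qed
  qed
  obtain a where a: "\<And>c. c \<noteq> a \<Longrightarrow> infinite {x. x \<in> UNIV - {0} \<and> F x = c}"
    using great_Picard_infinite[OF open_UNIV UNIV_I hol 1 2] by metis
  \<comment> \<open>With k = 1/w the equation becomes F(w)^2 = 1/b^2. Its two roots 1/b and -1/b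
    differ, so at least one of them is not the exceptional value.\<close>
  obtain c where c: "c \<noteq> a" "c\<^sup>2 = 1 / b\<^sup>2"
  proof (cases "1 / b = a")
    case True
    then have "- (1 / b) \<noteq> a" using assms by auto
    then show ?thesis using that[of "- (1 / b)"] by (simp add: power_divide)
  qed (use that[of "1 / b"] in \<open>simp add: power_divide\<close>)
  have "inverse ` {x. x \<in> UNIV - {0} \<and> F x = c} \<subseteq> {k. k \<noteq> 0 \<and> b\<^sup>2 * (sin k)\<^sup>2 = k\<^sup>2}"
  proof (rule image_subsetI, rule CollectI, rule conjI)
    fix x assume "x \<in> {x. x \<in> UNIV - {0} \<and> F x = c}"
    then have x: "x \<noteq> 0" "F x = c" by auto
    then show "inverse x \<noteq> 0" by simp
    have "b\<^sup>2 * (F x)\<^sup>2 = 1" unfolding x(2) c(2) using assms by simp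
    then show "b\<^sup>2 * (sin (inverse x))\<^sup>2 = (inverse x)\<^sup>2"
      using x(1) by (simp add: F_def power_mult_distrib field_simps)
  qed
  moreover have "infinite (inverse ` {x. x \<in> UNIV - {0} \<and> F x = c})"
  proof
    assume "finite (inverse ` {x. x \<in> UNIV - {0} \<and> F x = c})"
    then have "finite {x. x \<in> UNIV - {0} \<and> F x = c}" by (rule finite_imageD) (simp add: inj_on_def)
    then show False using a[OF c(1)] by simp
  qed
  ultimately show ?thesis by (rule infinite_super)
qed

text \<open>On the imaginary axis the equation reads |b| sinh y = y with y \<ge> 0, and a quadratic
  lower bound for sinh confines y.\<close>

lemma sinh_ge_quarter_square:
  assumes "y \<ge> 0" shows "y\<^sup>2 / 4 \<le> sinh (y::real)"
proof -
  have "1 + y + y\<^sup>2 / 2 \<le> exp y" by (rule exp_lower_Taylor_quadratic[OF assms])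
  moreover obtain e where e: "e = exp (- y)" by blast
  moreover have "e \<le> 1" using assms e by simp
  ultimately have "y\<^sup>2 / 2 \<le> exp y - e" using assms by (smt (verit))
  then show ?thesis unfolding sinh_field_def e[symmetric] by simp
qed

text \<open>A real square puts \<open>k\<close> on one of the two axes, where all solutions are
  bounded; a nonconstant entire function has finitely many zeros in a disk.\<close>

lemma finite_sin_eq_linear_real_square:
  fixes b :: real
  assumes "b \<noteq> 0"
  shows "finite {k::complex. (of_real b)\<^sup>2 * (sin k)\<^sup>2 = k\<^sup>2 \<and> k\<^sup>2 \<in> \<real>}"
proof -
  \<comment> \<open>The first bound is for the real axis, where |sin| \<le> 1; the second comes from
    \<open>sinh_ge_quarter_square\<close> on the imaginary axis.\<close>
  define R where "R = max \<bar>b\<bar> (4 / \<bar>b\<bar>)"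
  let ?F = "\<lambda>k::complex. (of_real b)\<^sup>2 * (sin k)\<^sup>2 - k\<^sup>2"
  have "finite {k \<in> cball 0 R. ?F k = 0}"
  proof (rule holomorphic_compact_finite_zeros[of _ UNIV])
    show "?F holomorphic_on UNIV" by (intro holomorphic_intros)
    show "\<not> ?F constant_on UNIV"
    proof
      assume "?F constant_on UNIV"
      then obtain c where c: "\<And>k. ?F k = c" unfolding constant_on_def by blast
      \<comment> \<open>The sine vanishes at both points while k^2 does not, so the function cannot
        be constant.\<close>
      have "?F (of_real (2 * pi)) = ?F 0" unfolding c ..
      moreover have "sin (complex_of_real (2 * pi)) = 0" by (subst sin_of_real) simp
      ultimately show False by simp
    qed
  qed auto
  moreover have "k \<in> cball 0 R" if k: "(of_real b)\<^sup>2 * (sin k)\<^sup>2 = k\<^sup>2" "k\<^sup>2 \<in> \<real>" for k :: complex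
  proof -
    have "(\<bar>b\<bar> * norm (sin k))\<^sup>2 = (norm k)\<^sup>2"
      using arg_cong[OF k(1), of norm] by (simp only: norm_mult norm_power norm_of_real power_mult_distrib)
    then have n: "\<bar>b\<bar> * norm (sin k) = norm k"
      by (rule power2_eq_imp_eq) auto
    have "Re k * Im k = 0" using k(2) by (auto simp: complex_is_Real_iff power2_eq_square)
    then consider "Im k = 0" | "Re k = 0" by auto
    then have "norm k \<le> R"
    proof cases
      case 1
      then obtain x where kr: "k = of_real x" by (metis complex_is_Real_iff Reals_cases)
      have "norm (sin k) = \<bar>sin x\<bar>" by (simp add: kr sin_of_real)
      then have "norm (sin k) \<le> 1" by simp
      then have "norm k \<le> \<bar>b\<bar>" using n mult_left_mono[of "norm (sin k)" 1 "\<bar>b\<bar>"] by simp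
      then show ?thesis by (simp add: R_def)
    next
      case 2
      define y where "y = \<bar>Im k\<bar>"
      have ky: "norm k = y" using 2 by (simp add: y_def cmod_def)
      have "k = \<i> * of_real (Im k)" using 2 by (simp add: complex_eq_iff)
      then have "sin k = \<i> * of_real (sinh (Im k))"
        by (metis sin_imaginary)
      then have "norm (sin k) = \<bar>sinh (Im k)\<bar>" by (simp add: norm_mult)
      also have "\<dots> = sinh y" by (simp add: y_def)
      finally have s: "\<bar>b\<bar> * sinh y = y" using n ky by simp
      have "\<bar>b\<bar> * (y\<^sup>2 / 4) \<le> y"
        using mult_left_mono[OF sinh_ge_quarter_square[of y], of "\<bar>b\<bar>"] s by (simp add: y_def)
      then have "y \<le> 4 / \<bar>b\<bar>"
      proof (cases "y = 0")
        case False
        then have "y > 0" by (simp add: y_def)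
        moreover have "(\<bar>b\<bar> * y) * y \<le> 4 * y"
          using \<open>\<bar>b\<bar> * (y\<^sup>2 / 4) \<le> y\<close> by (simp add: power2_eq_square)
        ultimately have "\<bar>b\<bar> * y \<le> 4" by (simp only: mult_le_cancel_right_pos)
        then show ?thesis using assms by (simp add: field_simps)
      qed simp
      then show ?thesis by (simp add: ky R_def)
    qed
    then show ?thesis by simp
  qed
  ultimately show ?thesis
    by (elim finite_subset[rotated]) auto
qed

section \<open>The spectrum and its real points\<close>

lemma Spec_A4_iff:
  assumes "m \<noteq> 0" "\<sigma> * \<sigma> = 1" "k \<noteq> 0"
  shows "of_real m * k\<^sup>2 \<in> Spec Dom_D (op_AD (A4 (m + \<sigma>) (m - \<sigma>)))
    \<longleftrightarrow> (of_real (1 + 2 * (m * \<sigma>)))\<^sup>2 * (sin k)\<^sup>2 = k\<^sup>2"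
proof -
  interpret A4_pencil m \<sigma> k "of_real m * k\<^sup>2" by unfold_locales (use assms in auto)
  show ?thesis using Spec_iff by simp
qed

lemma Spec_A4_eq:
  assumes "m \<noteq> 0" "\<sigma> * \<sigma> = 1"
  shows "Spec Dom_D (op_AD (A4 (m + \<sigma>) (m - \<sigma>)))
    = insert 0 ((\<lambda>k. of_real m * k\<^sup>2) ` {k. k \<noteq> 0 \<and> (of_real (1 + 2 * (m * \<sigma>)))\<^sup>2 * (sin k)\<^sup>2 = k\<^sup>2})"
    (is "?S = insert 0 (?f ` ?K)")
proof (intro set_eqI iffI)
  fix z assume z: "z \<in> ?S"
  show "z \<in> insert 0 (?f ` ?K)"
  proof (cases "z = 0")
    case False
    define k where "k = csqrt (z / of_real m)"
    have "of_real m * k\<^sup>2 = z" "k \<noteq> 0" using False assms(1) by (auto simp: k_def)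
    then show ?thesis using z Spec_A4_iff[OF assms, of k] by auto
  qed simp
next
  fix z assume "z \<in> insert 0 (?f ` ?K)"
  then show "z \<in> ?S" using zero_in_Spec Spec_A4_iff[OF assms] by auto
qed

theorem theorem27:
  fixes a d :: real
  assumes "\<bar>a - d\<bar> = 2" and "a \<noteq> 1" and "a \<noteq> -1"
  shows "if (a, d) = (1/2, -3/2) \<or> (a, d) = (-1/2, 3/2)
         then Spec Dom_D (op_AD (A4 a d)) = {0}
         else infinite (Spec Dom_D (op_AD (A4 a d))) \<and>
              finite (Spec Dom_D (op_AD (A4 a d)) \<inter> \<real>)"
proof -
  define m \<sigma> where "m = (a + d) / 2" and "\<sigma> = (a - d) / 2"
  define b where "b = 1 + 2 * (m * \<sigma>)"
  have ad: "a = m + \<sigma>" "d = m - \<sigma>" by (auto simp: m_def \<sigma>_def field_simps)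
  have \<sigma>: "\<sigma> = 1 \<or> \<sigma> = -1" using assms(1) by (auto simp: \<sigma>_def)
  have m: "m \<noteq> 0" using assms(2,3) \<sigma> ad by auto
  have \<sigma>2: "\<sigma> * \<sigma> = 1" using \<sigma> by auto
  \<comment> \<open>\<open>b = 0\<close> means m = - \<sigma>/2, that is a = \<sigma>/2 and d = - 3
    \<sigma>/2.\<close>
  have b0: "b = 0 \<longleftrightarrow> (a, d) = (1/2, -3/2) \<or> (a, d) = (-1/2, 3/2)"
    using \<sigma> by (auto simp: b_def ad)
  define K where "K = {k::complex. k \<noteq> 0 \<and> (of_real b)\<^sup>2 * (sin k)\<^sup>2 = k\<^sup>2}"
  define f where "f k = of_real m * k\<^sup>2" for k :: complex
  have S: "Spec Dom_D (op_AD (A4 a d)) = insert 0 (f ` K)"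
    using Spec_A4_eq[OF m \<sigma>2] unfolding ad K_def b_def f_def[abs_def] by simp
  show ?thesis
  proof (cases "b = 0")
    case True
    then have "K = {}" by (auto simp: K_def)
    then show ?thesis using b0 True S by simp
  next
    case False
    have "infinite K" unfolding K_def by (rule infinite_sin_eq_linear) (use False in simp)
    have "infinite (f ` K)"
    proof
      assume "finite (f ` K)"
      with \<open>infinite K\<close> obtain k where k: "k \<in> K" "infinite {l \<in> K. f l = f k}"
        using pigeonhole_infinite by blast
      \<comment> \<open>Squaring is at most two-to-one, so infinitely many \<open>k\<close> give
        infinitely many spectral points.\<close>
      moreover have "{l \<in> K. f l = f k} \<subseteq> {k, - k}"
        using m by (auto simp: f_def power2_eq_iff)
      ultimately show False using finite_subset by blast
    qed
    moreover have "finite (insert 0 (f ` K) \<inter> \<real>)"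
    proof -
      have "k\<^sup>2 \<in> \<real>" if "f k \<in> \<real>" for k
      proof -
        have "f k / of_real m \<in> \<real>" using that by (intro Reals_divide Reals_of_real)
        then show ?thesis using m by (simp add: f_def)
      qed
      then have "insert 0 (f ` K) \<inter> \<real> \<subseteq> insert 0 (f ` {k. (of_real b)\<^sup>2 * (sin k)\<^sup>2 = k\<^sup>2 \<and> k\<^sup>2 \<in> \<real>})"
        unfolding K_def by blast
      then show ?thesis
        by (rule finite_subset) (intro finite.insertI finite_imageI finite_sin_eq_linear_real_square False)
    qed
    ultimately have "infinite (Spec Dom_D (op_AD (A4 a d))) \<and> finite (Spec Dom_D (op_AD (A4 a d)) \<inter> \<real>)"
      unfolding S by simp
    then show ?thesis unfolding b0[symmetric] using False by simp
  qed
qed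

end
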